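(* Let $(\mathfrak{L},[-,-],\{-,-,-\},R)$ be a modified Rota-Baxter Lie-Yamaguti algebra, $(V,[-,-]_V=0,\{-,-,-\}_V=0,R_V)$ an abelian modified Rota-Baxter Lie-Yamaguti algebra, and $(V;\rho,\theta,D,R_V)$ a representation of $(\mathfrak{L},[-,-],\{-,-,-\},R)$. Then abelian extensions of $(\mathfrak{L},[-,-],\{-,-,-\},R)$ by $(V,[-,-]_V,\{-,-,-\}_V,R_V)$ (with induced representation $(V;\rho,\theta,D,R_V)$), up to equivalence, are classified by the second cohomology group $\mathcal{H}^2_{\mathrm{MRBLY}}(\mathfrak{L},V)$ of $(\mathfrak{L},[-,-],\{-,-,-\},R)$ with coefficients in $(V;\rho,\theta,D,R_V)$: sending an abelian extension to the cohomology class of the 2-cocycle $((\nu,\psi),\chi)$ associated with any section induces a bijection between equivalence classes of such abelian extensions and $\mathcal{H}^2_{\mathrm{MRBLY}}(\mathfrak{L},V)$.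
   Context: Throughout, $\mathbb{K}$ is an algebraically closed field of characteristic zero; all vector spaces and (multi)linear maps are over $\mathbb{K}$. A Lie-Yamaguti algebra is a triple $(\mathfrak{L},[-,-],\{-,-,-\})$ of a vector space with a bilinear and a trilinear operation such that for all $x,y,z,a,b\in\mathfrak{L}$: (LY1) $[x,y]=-[y,x]$; (LY2) $\{x,y,z\}=-\{y,x,z\}$; (LY3) $[[x,y],z]+[[y,z],x]+[[z,x],y]+\{x,y,z\}+\{y,z,x\}+\{z,x,y\}=0$; (LY4) $\{[x,y],z,a\}+\{[z,x],y,a\}+\{[y,z],x,a\}=0$; (LY5) $\{a,b,[x,y]\}=[\{a,b,x\},y]+[x,\{a,b,y\}]$; (LY6) $\{a,b,\{x,y,z\}\}=\{\{a,b,x\},y,z\}+\{x,\{a,b,y\},z\}+\{x,y,\{a,b,z\}\}$. A modified Rota-Baxter Lie-Yamaguti algebra is a Lie-Yamaguti algebra with a linear map $R:\mathfrak{L}\to\mathfrak{L}$ such that $[Rx,Ry]=R([Rx,y]+[x,Ry])-[x,y]$ and $\{Rx,Ry,Rz\}=R(\{x,Ry,Rz\}+\{Rx,y,Rz\}+\{Rx,Ry,z\}+\{x,y,z\})-\{Rx,y,z\}-\{x,Ry,z\}-\{x,y,Rz\}$ for all $x,y,z$. It is abelian if both brackets vanish (any vector space with any linear endomorphism is such). Homomorphisms are linear maps preserving both brackets and intertwining the operators. A representation $(V;\rho,\theta,D)$ of a Lie-Yamaguti algebra $\mathfrak{L}$ consists of a vector space $V$, a linear map $\rho:\mathfrak{L}\to\mathfrak{gl}(V)$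 and bilinear maps $\theta,D:\mathfrak{L}\times\mathfrak{L}\to\mathfrak{gl}(V)$ such that for all $x,y,z,a,b\in\mathfrak{L}$: (R1) $D(x,y)-\theta(y,x)+\theta(x,y)+\rho([x,y])-\rho(x)\rho(y)+\rho(y)\rho(x)=0$; (R2) $D([x,y],z)+D([y,z],x)+D([z,x],y)=0$; (R3) $\theta([x,y],a)=\theta(x,a)\rho(y)-\theta(y,a)\rho(x)$; (R4) $D(a,b)\rho(x)=\rho(x)D(a,b)+\rho(\{a,b,x\})$; (R5) $\theta(x,[a,b])=\rho(a)\theta(x,b)-\rho(b)\theta(x,a)$; (R6) $D(a,b)\theta(x,y)=\theta(x,y)D(a,b)+\theta(\{a,b,x\},y)+\theta(x,\{a,b,y\})$; (R7) $\theta(a,\{x,y,z\})=\theta(y,z)\theta(a,x)-\theta(x,z)\theta(a,y)+D(x,y)\theta(a,z)$. A representation $(V;\rho,\theta,D,R_V)$ of $(\mathfrak{L},[-,-],\{-,-,-\},R)$ is a representation $(V;\rho,\theta,D)$ of the Lie-Yamaguti algebra with a linear map $R_V:V\to V$ such that for all $x,y\in\mathfrak{L}$, $u\in V$: $\rho(Rx)R_Vu=R_V(\rho(Rx)u+\rho(x)R_Vu)-\rho(x)u$, $\theta(Rx,Ry)R_Vu=R_V(\theta(Rx,Ry)u+\theta(Rx,y)R_Vu+\theta(x,Ry)R_Vu+\theta(x,y)u)-\theta(Rx,y)u-\theta(x,y)R_Vu-\theta(x,Ry)u$. Second cohomology. Set $[x,y]_R=[Rx,y]+[x,Ry]$, $\{x,y,z\}_R=\{x,Ry,Rz\}+\{Rx,y,Rz\}+\{Rx,Ry,z\}+\{x,y,z\}$,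 $\rho_R(x)u=\rho(Rx)u-R_V(\rho(x)u)$, $\theta_R(x,y)u=\theta(Rx,Ry)u+\theta(Rx,y)u+\theta(x,Ry)u-R_V(\theta(x,y)u)$, $D_R(x,y)u=D(Rx,Ry)u+D(Rx,y)u+D(x,Ry)u-R_V(D(x,y)u)$. Cochains: $\mathcal{C}^1_{\mathrm{MRBLY}}(\mathfrak{L},V)=\mathrm{Hom}(\mathfrak{L},V)$; $\mathcal{C}^2_{\mathrm{MRBLY}}(\mathfrak{L},V)$ consists of triples $((f,g),h)$ with $f\in\mathrm{Hom}(\wedge^2\mathfrak{L},V)$, $g\in\mathrm{Hom}(\wedge^2\mathfrak{L}\otimes\mathfrak{L},V)$, $h\in\mathrm{Hom}(\mathfrak{L},V)$. Differentials: $\mathrm{d}^1(h)=(\delta^1h,-\Phi^1(h))$, $\mathrm{d}^2((f,g),h)=(\delta^2(f,g),-\partial^1(h)-\Phi^2(f,g))$, where each of $\delta^1,\partial^1,\delta^2,\Phi^2$ has components $I,II$: $\delta^1_I(h)(x,y)=\rho(x)h(y)-\rho(y)h(x)-h([x,y])$; $\delta^1_{II}(h)(x,y,z)=D(x,y)h(z)+\theta(y,z)h(x)-\theta(x,z)h(y)-h(\{x,y,z\})$; $\partial^1$ is given by the same formulas as $\delta^1$ with $[-,-],\{-,-,-\},\rho,\theta,D$ replaced by $[-,-]_R,\{-,-,-\}_R,\rho_R,\theta_R,D_R$; $\delta^2_I(f,g)(x_1,y_1,x_2,y_2)=-\rho(x_2)g(x_1,y_1,y_2)+\rho(y_2)g(x_1,y_1,x_2)+g(x_1,y_1,[x_2,y_2])+D(x_1,y_1)f(x_2,y_2)-f(\{x_1,y_1,x_2\},y_2)-f(x_2,\{x_1,y_1,y_2\})$;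 $\delta^2_{II}(f,g)(x_1,y_1,x_2,y_2,z)=-\theta(y_2,z)g(x_1,y_1,x_2)+\theta(x_2,z)g(x_1,y_1,y_2)+D(x_1,y_1)g(x_2,y_2,z)-D(x_2,y_2)g(x_1,y_1,z)-g(\{x_1,y_1,x_2\},y_2,z)-g(x_2,\{x_1,y_1,y_2\},z)-g(x_2,y_2,\{x_1,y_1,z\})+g(x_1,y_1,\{x_2,y_2,z\})$; $\Phi^1(h)=h\circ R-R_V\circ h$; $\Phi^2_I(f)(x,y)=f(Rx,Ry)+f(x,y)-R_V(f(Rx,y)+f(x,Ry))$; $\Phi^2_{II}(g)(x,y,z)=g(Rx,Ry,Rz)+g(Rx,y,z)+g(x,Ry,z)+g(x,y,Rz)-R_V(g(Rx,Ry,z)+g(Rx,y,Rz)+g(x,Ry,Rz)+g(x,y,z))$. 2-cocycles are the elements of $\ker\mathrm{d}^2$, and $\mathcal{H}^2_{\mathrm{MRBLY}}(\mathfrak{L},V)=\ker\mathrm{d}^2/\mathrm{im}\,\mathrm{d}^1$. An abelian extension of $(\mathfrak{L},[-,-],\{-,-,-\},R)$ by $(V,0,0,R_V)$ is a short exact sequence $0\to V\xrightarrow{i}\hat{\mathfrak{L}}\xrightarrow{p}\mathfrak{L}\to0$ of homomorphisms of modified Rota-Baxter Lie-Yamaguti algebras, with $(\hat{\mathfrak{L}},[-,-]_{\hat{\mathfrak{L}}},\{-,-,-\}_{\hat{\mathfrak{L}}},\hat R)$ in the middle, such that $V$ (identified with $i(V)$) is an abelian ideal: $[u,v]_{\hat{\mathfrak{L}}}=0$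 and $\{-,u,v\}_{\hat{\mathfrak{L}}}=\{u,v,-\}_{\hat{\mathfrak{L}}}=0$ for all $u,v\in V$. A section is a linear map $s:\mathfrak{L}\to\hat{\mathfrak{L}}$ with $p\circ s=\mathrm{id}_{\mathfrak{L}}$. Two abelian extensions $\hat{\mathfrak{L}}_1,\hat{\mathfrak{L}}_2$ are equivalent if there is an isomorphism $\varphi:\hat{\mathfrak{L}}_1\to\hat{\mathfrak{L}}_2$ of modified Rota-Baxter Lie-Yamaguti algebras with $\varphi\circ i_1=i_2$ and $p_2\circ\varphi=p_1$. Given a section $s$, the induced representation on $V$ is $\rho(x)u=[s(x),u]_{\hat{\mathfrak{L}}}$, $\theta(x,y)u=\{u,s(x),s(y)\}_{\hat{\mathfrak{L}}}$, $D(x,y)u=\{s(x),s(y),u\}_{\hat{\mathfrak{L}}}$, together with $R_V$, and the associated 2-cocycle $((\nu,\psi),\chi)$ is $\nu(x,y)=[s(x),s(y)]_{\hat{\mathfrak{L}}}-s([x,y])$, $\psi(x,y,z)=\{s(x),s(y),s(z)\}_{\hat{\mathfrak{L}}}-s(\{x,y,z\})$, $\chi(x)=\hat R(s(x))-s(R(x))$.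
   Formalization: In θ_R (likewise D_R) the formula is corrected to θ(Rx,Ry)u+θ(x,y)u−R_V(θ(Rx,y)u+θ(x,Ry)u), and 2-cocycles must also satisfy the cyclic conditions from (LY3), (LY4); with the original definitions d²d¹≠0 and some cocycles come from no extension. *)

theory Defs
  imports
    "HOL-Computational_Algebra.Polynomial"
    "HOL-Library.Function_Algebras"
    "HOL-Library.Product_Plus"
begin

section \<open>Multilinear maps\<close>

definition bilinear_map ::
  "('k::field \<Rightarrow> 'a::ab_group_add \<Rightarrow> 'a) \<Rightarrow> ('k \<Rightarrow> 'b::ab_group_add \<Rightarrow> 'b) \<Rightarrow>
   ('k \<Rightarrow> 'c::ab_group_add \<Rightarrow> 'c) \<Rightarrow> ('a \<Rightarrow> 'b \<Rightarrow> 'c) \<Rightarrow> bool" where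
  "bilinear_map s1 s2 s3 f \<longleftrightarrow>
     (\<forall>x. Vector_Spaces.linear s2 s3 (f x)) \<and>
     (\<forall>y. Vector_Spaces.linear s1 s3 (\<lambda>x. f x y))"

definition trilinear_map ::
  "('k::field \<Rightarrow> 'a::ab_group_add \<Rightarrow> 'a) \<Rightarrow> ('k \<Rightarrow> 'b::ab_group_add \<Rightarrow> 'b) \<Rightarrow>
   ('k \<Rightarrow> 'c::ab_group_add \<Rightarrow> 'c) \<Rightarrow> ('k \<Rightarrow> 'd::ab_group_add \<Rightarrow> 'd) \<Rightarrow>
   ('a \<Rightarrow> 'b \<Rightarrow> 'c \<Rightarrow> 'd) \<Rightarrow> bool" where
  "trilinear_map s1 s2 s3 s4 f \<longleftrightarrow>
     (\<forall>x y. Vector_Spaces.linear s3 s4 (f x y)) \<and>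
     (\<forall>x z. Vector_Spaces.linear s2 s4 (\<lambda>y. f x y z)) \<and>
     (\<forall>y z. Vector_Spaces.linear s1 s4 (\<lambda>x. f x y z))"

section \<open>Modified Rota-Baxter Lie-Yamaguti algebras\<close>

text \<open>The underlying abelian group of a vector space is the whole type; only the scalar
  multiplication is part of the record.\<close>

record ('k, 'a) mrbly =
  scl :: "'k \<Rightarrow> 'a \<Rightarrow> 'a"
  brk :: "'a \<Rightarrow> 'a \<Rightarrow> 'a"
  trp :: "'a \<Rightarrow> 'a \<Rightarrow> 'a \<Rightarrow> 'a"
  rbo :: "'a \<Rightarrow> 'a"

definition lie_yamaguti :: "('k::field, 'a::ab_group_add) mrbly \<Rightarrow> bool" where
  "lie_yamaguti A \<longleftrightarrow>
     vector_space (scl A) \<and>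
     bilinear_map (scl A) (scl A) (scl A) (brk A) \<and>
     trilinear_map (scl A) (scl A) (scl A) (scl A) (trp A) \<and>
     (\<forall>x y. brk A x y = - brk A y x) \<and>
     (\<forall>x y z. trp A x y z = - trp A y x z) \<and>
     (\<forall>x y z. brk A (brk A x y) z + brk A (brk A y z) x + brk A (brk A z x) y
        + trp A x y z + trp A y z x + trp A z x y = 0) \<and>
     (\<forall>x y z a. trp A (brk A x y) z a + trp A (brk A z x) y a + trp A (brk A y z) x a = 0) \<and>
     (\<forall>a b x y. trp A a b (brk A x y) = brk A (trp A a b x) y + brk A x (trp A a b y)) \<and>
     (\<forall>a b x y z. trp A a b (trp A x y z) =
        trp A (trp A a b x) y z + trp A x (trp A a b y) z + trp A x y (trp A a b z))"

definition mrb_lie_yamaguti :: "('k::field, 'a::ab_group_add) mrbly \<Rightarrow> bool" where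
  "mrb_lie_yamaguti A \<longleftrightarrow>
     lie_yamaguti A \<and>
     Vector_Spaces.linear (scl A) (scl A) (rbo A) \<and>
     (\<forall>x y. brk A (rbo A x) (rbo A y) =
        rbo A (brk A (rbo A x) y + brk A x (rbo A y)) - brk A x y) \<and>
     (\<forall>x y z. trp A (rbo A x) (rbo A y) (rbo A z) =
        rbo A (trp A x (rbo A y) (rbo A z) + trp A (rbo A x) y (rbo A z)
               + trp A (rbo A x) (rbo A y) z + trp A x y z)
        - trp A (rbo A x) y z - trp A x (rbo A y) z - trp A x y (rbo A z))"

definition abelian_mrbly :: "('k::field, 'a::ab_group_add) mrbly \<Rightarrow> bool" where
  "abelian_mrbly A \<longleftrightarrow> (\<forall>x y. brk A x y = 0) \<and> (\<forall>x y z. trp A x y z = 0)"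

definition mrbly_hom ::
  "('k::field, 'a::ab_group_add) mrbly \<Rightarrow> ('k, 'b::ab_group_add) mrbly \<Rightarrow> ('a \<Rightarrow> 'b) \<Rightarrow> bool" where
  "mrbly_hom A B f \<longleftrightarrow>
     Vector_Spaces.linear (scl A) (scl B) f \<and>
     (\<forall>x y. f (brk A x y) = brk B (f x) (f y)) \<and>
     (\<forall>x y z. f (trp A x y z) = trp B (f x) (f y) (f z)) \<and>
     (\<forall>x. f (rbo A x) = rbo B (f x))"

definition mrbly_iso ::
  "('k::field, 'a::ab_group_add) mrbly \<Rightarrow> ('k, 'b::ab_group_add) mrbly \<Rightarrow> ('a \<Rightarrow> 'b) \<Rightarrow> bool" where
  "mrbly_iso A B f \<longleftrightarrow> mrbly_hom A B f \<and> bij f"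

section \<open>Representations\<close>

text \<open>The vector space \<open>V\<close> with its endomorphism is given as an abelian algebra; only its
  scalar multiplication and its operator enter the definition.\<close>

record ('l, 'v) rep =
  rho :: "'l \<Rightarrow> 'v \<Rightarrow> 'v"
  theta :: "'l \<Rightarrow> 'l \<Rightarrow> 'v \<Rightarrow> 'v"
  dop :: "'l \<Rightarrow> 'l \<Rightarrow> 'v \<Rightarrow> 'v"

definition ly_representation ::
  "('k::field, 'l::ab_group_add) mrbly \<Rightarrow> ('k, 'v::ab_group_add) mrbly \<Rightarrow> ('l, 'v) rep \<Rightarrow> bool" where
  "ly_representation L V M \<longleftrightarrow>
     vector_space (scl V) \<and>
     bilinear_map (scl L) (scl V) (scl V) (rho M) \<and>
     trilinear_map (scl L) (scl L) (scl V) (scl V) (theta M) \<and>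
     trilinear_map (scl L) (scl L) (scl V) (scl V) (dop M) \<and>
     (\<forall>x y u. dop M x y u - theta M y x u + theta M x y u + rho M (brk L x y) u
        - rho M x (rho M y u) + rho M y (rho M x u) = 0) \<and>
     (\<forall>x y z u. dop M (brk L x y) z u + dop M (brk L y z) x u + dop M (brk L z x) y u = 0) \<and>
     (\<forall>x y a u. theta M (brk L x y) a u = theta M x a (rho M y u) - theta M y a (rho M x u)) \<and>
     (\<forall>a b x u. dop M a b (rho M x u) = rho M x (dop M a b u) + rho M (trp L a b x) u) \<and>
     (\<forall>x a b u. theta M x (brk L a b) u = rho M a (theta M x b u) - rho M b (theta M x a u)) \<and>
     (\<forall>a b x y u. dop M a b (theta M x y u) =
        theta M x y (dop M a b u) + theta M (trp L a b x) y u + theta M x (trp L a b y) u) \<and>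
     (\<forall>a x y z u. theta M a (trp L x y z) u =
        theta M y z (theta M a x u) - theta M x z (theta M a y u) + dop M x y (theta M a z u))"

definition mrb_representation ::
  "('k::field, 'l::ab_group_add) mrbly \<Rightarrow> ('k, 'v::ab_group_add) mrbly \<Rightarrow> ('l, 'v) rep \<Rightarrow> bool" where
  "mrb_representation L V M \<longleftrightarrow>
     ly_representation L V M \<and>
     Vector_Spaces.linear (scl V) (scl V) (rbo V) \<and>
     (\<forall>x u. rho M (rbo L x) (rbo V u) =
        rbo V (rho M (rbo L x) u + rho M x (rbo V u)) - rho M x u) \<and>
     (\<forall>x y u. theta M (rbo L x) (rbo L y) (rbo V u) =
        rbo V (theta M (rbo L x) (rbo L y) u + theta M (rbo L x) y (rbo V u)
               + theta M x (rbo L y) (rbo V u) + theta M x y u)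
        - theta M (rbo L x) y u - theta M x y (rbo V u) - theta M x (rbo L y) u)"

section \<open>Second cohomology\<close>

definition desc_mrbly :: "('k::field, 'l::ab_group_add) mrbly \<Rightarrow> ('k, 'l) mrbly" where
  "desc_mrbly L = L\<lparr>
     brk := (\<lambda>x y. brk L (rbo L x) y + brk L x (rbo L y)),
     trp := (\<lambda>x y z. trp L x (rbo L y) (rbo L z) + trp L (rbo L x) y (rbo L z)
                     + trp L (rbo L x) (rbo L y) z + trp L x y z)\<rparr>"

text \<open>
  The descendent maps \<open>\<theta>\<^sub>R\<close> and \<open>D\<^sub>R\<close> are the ones forced by the compatibility of \<open>\<theta>\<close> and \<open>D\<close>
  with the operators: \<open>\<theta>\<^sub>R(x,y)u = \<theta>(Rx,Ry)u + \<theta>(x,y)u - R\<^sub>V(\<theta>(Rx,y)u + \<theta>(x,Ry)u)\<close>, and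
  likewise \<open>D\<^sub>R\<close>.  With the terms \<open>\<theta>(x,y)u\<close> and \<open>\<theta>(Rx,y)u + \<theta>(x,Ry)u\<close> interchanged, the
  composite of the differentials \<open>d1\<close>, \<open>d2\<close> below is not zero, and the cochain associated with a
  section of an extension is not a cocycle.
\<close>

definition desc_rep ::
  "('k::field, 'l::ab_group_add) mrbly \<Rightarrow> ('k, 'v::ab_group_add) mrbly \<Rightarrow> ('l, 'v) rep \<Rightarrow> ('l, 'v) rep" where
  "desc_rep L V M = \<lparr>
     rho = (\<lambda>x u. rho M (rbo L x) u - rbo V (rho M x u)),
     theta = (\<lambda>x y u. theta M (rbo L x) (rbo L y) u + theta M x y u
                      - rbo V (theta M (rbo L x) y u + theta M x (rbo L y) u)),
     dop = (\<lambda>x y u. dop M (rbo L x) (rbo L y) u + dop M x y u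
                    - rbo V (dop M (rbo L x) y u + dop M x (rbo L y) u))\<rparr>"

type_synonym ('l, 'v) cochain1 = "'l \<Rightarrow> 'v"
type_synonym ('l, 'v) cochain2 = "(('l \<Rightarrow> 'l \<Rightarrow> 'v) \<times> ('l \<Rightarrow> 'l \<Rightarrow> 'l \<Rightarrow> 'v)) \<times> ('l \<Rightarrow> 'v)"
type_synonym ('l, 'v) cochain3 =
  "(('l \<Rightarrow> 'l \<Rightarrow> 'l \<Rightarrow> 'l \<Rightarrow> 'v) \<times> ('l \<Rightarrow> 'l \<Rightarrow> 'l \<Rightarrow> 'l \<Rightarrow> 'l \<Rightarrow> 'v)) \<times>
   (('l \<Rightarrow> 'l \<Rightarrow> 'v) \<times> ('l \<Rightarrow> 'l \<Rightarrow> 'l \<Rightarrow> 'v))"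

definition C1 :: "('k::field, 'l::ab_group_add) mrbly \<Rightarrow> ('k, 'v::ab_group_add) mrbly \<Rightarrow>
    ('l, 'v) cochain1 set" where
  "C1 L V = {h. Vector_Spaces.linear (scl L) (scl V) h}"

definition C2 :: "('k::field, 'l::ab_group_add) mrbly \<Rightarrow> ('k, 'v::ab_group_add) mrbly \<Rightarrow>
    ('l, 'v) cochain2 set" where
  "C2 L V = {((f, g), h).
     bilinear_map (scl L) (scl L) (scl V) f \<and> (\<forall>x. f x x = 0) \<and>
     trilinear_map (scl L) (scl L) (scl L) (scl V) g \<and> (\<forall>x z. g x x z = 0) \<and>
     Vector_Spaces.linear (scl L) (scl V) h}"

definition delta1 ::
  "('k::field, 'l::ab_group_add) mrbly \<Rightarrow> ('l, 'v::ab_group_add) rep \<Rightarrow> ('l \<Rightarrow> 'v) \<Rightarrow>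
   ('l \<Rightarrow> 'l \<Rightarrow> 'v) \<times> ('l \<Rightarrow> 'l \<Rightarrow> 'l \<Rightarrow> 'v)" where
  "delta1 L M h =
     ((\<lambda>x y. rho M x (h y) - rho M y (h x) - h (brk L x y)),
      (\<lambda>x y z. dop M x y (h z) + theta M y z (h x) - theta M x z (h y) - h (trp L x y z)))"

definition partial1 ::
  "('k::field, 'l::ab_group_add) mrbly \<Rightarrow> ('k, 'v::ab_group_add) mrbly \<Rightarrow> ('l, 'v) rep \<Rightarrow> ('l \<Rightarrow> 'v) \<Rightarrow>
   ('l \<Rightarrow> 'l \<Rightarrow> 'v) \<times> ('l \<Rightarrow> 'l \<Rightarrow> 'l \<Rightarrow> 'v)" where
  "partial1 L V M h = delta1 (desc_mrbly L) (desc_rep L V M) h"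

definition delta2 ::
  "('k::field, 'l::ab_group_add) mrbly \<Rightarrow> ('l, 'v::ab_group_add) rep \<Rightarrow>
   ('l \<Rightarrow> 'l \<Rightarrow> 'v) \<times> ('l \<Rightarrow> 'l \<Rightarrow> 'l \<Rightarrow> 'v) \<Rightarrow>
   ('l \<Rightarrow> 'l \<Rightarrow> 'l \<Rightarrow> 'l \<Rightarrow> 'v) \<times> ('l \<Rightarrow> 'l \<Rightarrow> 'l \<Rightarrow> 'l \<Rightarrow> 'l \<Rightarrow> 'v)" where
  "delta2 L M = (\<lambda>(f, g).
     ((\<lambda>x1 y1 x2 y2.
         - rho M x2 (g x1 y1 y2) + rho M y2 (g x1 y1 x2) + g x1 y1 (brk L x2 y2)
         + dop M x1 y1 (f x2 y2) - f (trp L x1 y1 x2) y2 - f x2 (trp L x1 y1 y2)),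
      (\<lambda>x1 y1 x2 y2 z.
         - theta M y2 z (g x1 y1 x2) + theta M x2 z (g x1 y1 y2)
         + dop M x1 y1 (g x2 y2 z) - dop M x2 y2 (g x1 y1 z)
         - g (trp L x1 y1 x2) y2 z - g x2 (trp L x1 y1 y2) z - g x2 y2 (trp L x1 y1 z)
         + g x1 y1 (trp L x2 y2 z))))"

definition Phi1 ::
  "('k::field, 'l::ab_group_add) mrbly \<Rightarrow> ('k, 'v::ab_group_add) mrbly \<Rightarrow> ('l \<Rightarrow> 'v) \<Rightarrow> ('l \<Rightarrow> 'v)" where
  "Phi1 L V h = (\<lambda>x. h (rbo L x) - rbo V (h x))"

definition Phi2 ::
  "('k::field, 'l::ab_group_add) mrbly \<Rightarrow> ('k, 'v::ab_group_add) mrbly \<Rightarrow>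
   ('l \<Rightarrow> 'l \<Rightarrow> 'v) \<times> ('l \<Rightarrow> 'l \<Rightarrow> 'l \<Rightarrow> 'v) \<Rightarrow>
   ('l \<Rightarrow> 'l \<Rightarrow> 'v) \<times> ('l \<Rightarrow> 'l \<Rightarrow> 'l \<Rightarrow> 'v)" where
  "Phi2 L V = (\<lambda>(f, g).
     ((\<lambda>x y. f (rbo L x) (rbo L y) + f x y - rbo V (f (rbo L x) y + f x (rbo L y))),
      (\<lambda>x y z.
         g (rbo L x) (rbo L y) (rbo L z) + g (rbo L x) y z + g x (rbo L y) z + g x y (rbo L z)
         - rbo V (g (rbo L x) (rbo L y) z + g (rbo L x) y (rbo L z)
                  + g x (rbo L y) (rbo L z) + g x y z))))"

definition d1 ::
  "('k::field, 'l::ab_group_add) mrbly \<Rightarrow> ('k, 'v::ab_group_add) mrbly \<Rightarrow> ('l, 'v) rep \<Rightarrow>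
   ('l, 'v) cochain1 \<Rightarrow> ('l, 'v) cochain2" where
  "d1 L V M h = (delta1 L M h, - Phi1 L V h)"

definition d2 ::
  "('k::field, 'l::ab_group_add) mrbly \<Rightarrow> ('k, 'v::ab_group_add) mrbly \<Rightarrow> ('l, 'v) rep \<Rightarrow>
   ('l, 'v) cochain2 \<Rightarrow> ('l, 'v) cochain3" where
  "d2 L V M = (\<lambda>(fg, h). (delta2 L M fg, - partial1 L V M h - Phi2 L V fg))"

text \<open>
  Yamaguti's second operator \<open>\<delta>\<^sup>*\<close> on pairs \<open>(f,g)\<close>.  In Yamaguti's cohomology of Lie-Yamaguti
  algebras the 2-cocycles are the pairs annihilated by both \<open>\<delta>\<close> and \<open>\<delta>\<^sup>*\<close>.  The components of
  \<open>\<delta>\<close> express that the deformed brackets satisfy the two derivation identities, and those of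
  \<open>\<delta>\<^sup>*\<close> the two cyclic identities; the former do not
  imply the latter, so \<open>Z2\<close> requires both.
\<close>

definition delta_star ::
  "('k::field, 'l::ab_group_add) mrbly \<Rightarrow> ('l, 'v::ab_group_add) rep \<Rightarrow>
   ('l \<Rightarrow> 'l \<Rightarrow> 'v) \<times> ('l \<Rightarrow> 'l \<Rightarrow> 'l \<Rightarrow> 'v) \<Rightarrow>
   ('l \<Rightarrow> 'l \<Rightarrow> 'l \<Rightarrow> 'v) \<times> ('l \<Rightarrow> 'l \<Rightarrow> 'l \<Rightarrow> 'l \<Rightarrow> 'v)" where
  "delta_star L M = (\<lambda>(f, g).
     ((\<lambda>x y z.
         - rho M x (f y z) - rho M y (f z x) - rho M z (f x y)
         + f (brk L x y) z + f (brk L y z) x + f (brk L z x) y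
         + g x y z + g y z x + g z x y),
      (\<lambda>x y z a.
         theta M x a (f y z) + theta M y a (f z x) + theta M z a (f x y)
         + g (brk L x y) z a + g (brk L y z) x a + g (brk L z x) y a)))"

definition Z2 ::
  "('k::field, 'l::ab_group_add) mrbly \<Rightarrow> ('k, 'v::ab_group_add) mrbly \<Rightarrow> ('l, 'v) rep \<Rightarrow>
   ('l, 'v) cochain2 set" where
  "Z2 L V M = {c \<in> C2 L V. d2 L V M c = 0 \<and> delta_star L M (fst c) = 0}"

definition B2 ::
  "('k::field, 'l::ab_group_add) mrbly \<Rightarrow> ('k, 'v::ab_group_add) mrbly \<Rightarrow> ('l, 'v) rep \<Rightarrow>
   ('l, 'v) cochain2 set" where
  "B2 L V M = d1 L V M ` C1 L V"

definition coh_class ::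
  "('k::field, 'l::ab_group_add) mrbly \<Rightarrow> ('k, 'v::ab_group_add) mrbly \<Rightarrow> ('l, 'v) rep \<Rightarrow>
   ('l, 'v) cochain2 \<Rightarrow> ('l, 'v) cochain2 set" where
  "coh_class L V M c = {c + b | b. b \<in> B2 L V M}"

definition H2 ::
  "('k::field, 'l::ab_group_add) mrbly \<Rightarrow> ('k, 'v::ab_group_add) mrbly \<Rightarrow> ('l, 'v) rep \<Rightarrow>
   ('l, 'v) cochain2 set set" where
  "H2 L V M = coh_class L V M ` Z2 L V M"

section \<open>Abelian extensions\<close>

record ('k, 'l, 'v, 'e) extension =
  mid :: "('k, 'e) mrbly"
  inc :: "'v \<Rightarrow> 'e"
  prj :: "'e \<Rightarrow> 'l"

definition abelian_extension ::
  "('k::field, 'l::ab_group_add) mrbly \<Rightarrow> ('k, 'v::ab_group_add) mrbly \<Rightarrow>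
   ('k, 'l, 'v, 'e::ab_group_add) extension \<Rightarrow> bool" where
  "abelian_extension L V E \<longleftrightarrow>
     mrb_lie_yamaguti (mid E) \<and>
     mrbly_hom V (mid E) (inc E) \<and> mrbly_hom (mid E) L (prj E) \<and>
     inj (inc E) \<and> surj (prj E) \<and> range (inc E) = {e. prj E e = 0} \<and>
     (\<forall>u v. brk (mid E) (inc E u) (inc E v) = 0) \<and>
     (\<forall>e u v. trp (mid E) e (inc E u) (inc E v) = 0 \<and> trp (mid E) (inc E u) (inc E v) e = 0)"

definition ext_section ::
  "('k::field, 'l::ab_group_add) mrbly \<Rightarrow> ('k, 'l, 'v, 'e::ab_group_add) extension \<Rightarrow>
   ('l \<Rightarrow> 'e) \<Rightarrow> bool" where
  "ext_section L E s \<longleftrightarrow>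
     Vector_Spaces.linear (scl L) (scl (mid E)) s \<and> prj E \<circ> s = id"

text \<open>In the following two definitions elements of the ideal \<open>i(V)\<close> are read as elements of
  \<open>V\<close> through \<open>inv (inc E)\<close>.\<close>

definition induced_rep ::
  "('k, 'l, 'v, 'e) extension \<Rightarrow> ('l \<Rightarrow> 'e) \<Rightarrow> ('l, 'v) rep" where
  "induced_rep E s = \<lparr>
     rho = (\<lambda>x u. inv (inc E) (brk (mid E) (s x) (inc E u))),
     theta = (\<lambda>x y u. inv (inc E) (trp (mid E) (inc E u) (s x) (s y))),
     dop = (\<lambda>x y u. inv (inc E) (trp (mid E) (s x) (s y) (inc E u)))\<rparr>"

definition assoc_cocycle ::
  "('k, 'l) mrbly \<Rightarrow> ('k, 'l, 'v, 'e::ab_group_add) extension \<Rightarrow> ('l \<Rightarrow> 'e) \<Rightarrow>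
   ('l, 'v) cochain2" where
  "assoc_cocycle L E s =
     (((\<lambda>x y. inv (inc E) (brk (mid E) (s x) (s y) - s (brk L x y))),
       (\<lambda>x y z. inv (inc E) (trp (mid E) (s x) (s y) (s z) - s (trp L x y z)))),
      (\<lambda>x. inv (inc E) (rbo (mid E) (s x) - s (rbo L x))))"

definition abelian_extensions ::
  "('k::field, 'l::ab_group_add) mrbly \<Rightarrow> ('k, 'v::ab_group_add) mrbly \<Rightarrow> ('l, 'v) rep \<Rightarrow>
   ('k, 'l, 'v, 'e::ab_group_add) extension set" where
  "abelian_extensions L V M =
     {E. abelian_extension L V E \<and> (\<forall>s. ext_section L E s \<longrightarrow> induced_rep E s = M)}"

definition ext_equivalent ::
  "('k::field, 'l, 'v, 'e::ab_group_add) extension \<Rightarrow> ('k, 'l, 'v, 'f::ab_group_add) extension \<Rightarrow>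
   bool" where
  "ext_equivalent E1 E2 \<longleftrightarrow>
     (\<exists>\<phi>. mrbly_iso (mid E1) (mid E2) \<phi> \<and> \<phi> \<circ> inc E1 = inc E2 \<and> prj E2 \<circ> \<phi> = prj E1)"

definition ext_equiv_rel ::
  "('k::field, 'l::ab_group_add) mrbly \<Rightarrow> ('k, 'v::ab_group_add) mrbly \<Rightarrow> ('l, 'v) rep \<Rightarrow>
   (('k, 'l, 'v, 'e::ab_group_add) extension \<times> ('k, 'l, 'v, 'e) extension) set" where
  "ext_equiv_rel L V M =
     {(E1, E2). E1 \<in> abelian_extensions L V M \<and> E2 \<in> abelian_extensions L V M \<and>
                ext_equivalent E1 E2}"

text \<open>The common cohomology class of the cocycles associated with the sections of \<open>E\<close>.\<close>

definition ext_class ::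
  "('k::field, 'l::ab_group_add) mrbly \<Rightarrow> ('k, 'v::ab_group_add) mrbly \<Rightarrow> ('l, 'v) rep \<Rightarrow>
   ('k, 'l, 'v, 'e::ab_group_add) extension \<Rightarrow> ('l, 'v) cochain2 set" where
  "ext_class L V M E =
     (THE c. \<forall>s. ext_section L E s \<longrightarrow> c = coh_class L V M (assoc_cocycle L E s))"

end

theory Submission
  imports Defs
begin

text \<open>
  A 2-cochain \<open>c\<close> deforms the semidirect product on \<open>L \<times> V\<close>, and the resulting structure satisfies
  the axioms iff \<open>c\<close> is a cocycle.  A section \<open>s\<close> of an extension \<open>E\<close> makes \<open>(x, u) \<mapsto> s x + i u\<close>
  an isomorphism onto \<open>E\<close> from the structure deformed by the cochain of \<open>s\<close>: so that cochain is a
  cocycle, because the axioms of \<open>E\<close> pull back along the isomorphism, and it determines \<open>E\<close> up to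
  equivalence.  Changing \<open>s\<close> to \<open>s + i \<circ> h\<close> adds \<open>d1 h\<close> to the cocycle, and every change of section
  has this form.
\<close>

section \<open>Multilinear maps\<close>

lemma linear_simps:
  assumes "Vector_Spaces.linear s1 s2 f"
  shows "f (x + y) = f x + f y" "f 0 = 0" "f (- x) = - f x" "f (x - y) = f x - f y"
    "f (s1 k x) = s2 k (f x)"
proof -
  interpret Vector_Spaces.linear s1 s2 f by fact
  show "f (x + y) = f x + f y" "f 0 = 0" "f (- x) = - f x" "f (x - y) = f x - f y"
    "f (s1 k x) = s2 k (f x)"
    by (simp_all add: add scale zero neg diff)
qed

lemma vector_space_simps:
  assumes "vector_space s"
  shows "s k (x + y) = s k x + s k y" "s k 0 = 0" "s k (- x) = - s k x" "s k (x - y) = s k x - s k y"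
proof -
  interpret vector_space s by fact
  show "s k (x + y) = s k x + s k y" "s k 0 = 0" "s k (- x) = - s k x" "s k (x - y) = s k x - s k y"
    by (simp_all add: scale_right_distrib scale_right_diff_distrib)
qed

lemma bilinear_map_simps:
  assumes "bilinear_map s1 s2 s3 f"
  shows "f (x + x') y = f x y + f x' y" "f 0 y = 0" "f (- x) y = - f x y" "f (x - x') y = f x y - f x' y"
    "f (s1 k x) y = s3 k (f x y)"
    "f x (y + y') = f x y + f x y'" "f x 0 = 0" "f x (- y) = - f x y" "f x (y - y') = f x y - f x y'"
    "f x (s2 k y) = s3 k (f x y)"
proof -
  have 1: "Vector_Spaces.linear s2 s3 (f x)" and 2: "Vector_Spaces.linear s1 s3 (\<lambda>x. f x y)" for x y
    using assms by (auto simp: bilinear_map_def)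
  show "f (x + x') y = f x y + f x' y" "f 0 y = 0" "f (- x) y = - f x y" "f (x - x') y = f x y - f x' y"
    "f (s1 k x) y = s3 k (f x y)"
    using linear_simps[OF 2] .
  show "f x (y + y') = f x y + f x y'" "f x 0 = 0" "f x (- y) = - f x y" "f x (y - y') = f x y - f x y'"
    "f x (s2 k y) = s3 k (f x y)"
    using linear_simps[OF 1] .
qed

lemma trilinear_map_simps:
  assumes "trilinear_map s1 s2 s3 s4 f"
  shows "f (x + x') y z = f x y z + f x' y z" "f 0 y z = 0" "f (- x) y z = - f x y z"
    "f (x - x') y z = f x y z - f x' y z" "f (s1 k x) y z = s4 k (f x y z)"
    "f x (y + y') z = f x y z + f x y' z" "f x 0 z = 0" "f x (- y) z = - f x y z"
    "f x (y - y') z = f x y z - f x y' z" "f x (s2 k y) z = s4 k (f x y z)"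
    "f x y (z + z') = f x y z + f x y z'" "f x y 0 = 0" "f x y (- z) = - f x y z"
    "f x y (z - z') = f x y z - f x y z'" "f x y (s3 k z) = s4 k (f x y z)"
proof -
  have 1: "Vector_Spaces.linear s3 s4 (f x y)" and 2: "Vector_Spaces.linear s2 s4 (\<lambda>y. f x y z)"
    and 3: "Vector_Spaces.linear s1 s4 (\<lambda>x. f x y z)" for x y z
    using assms by (auto simp: trilinear_map_def)
  show "f (x + x') y z = f x y z + f x' y z" "f 0 y z = 0" "f (- x) y z = - f x y z"
    "f (x - x') y z = f x y z - f x' y z" "f (s1 k x) y z = s4 k (f x y z)"
    using linear_simps[OF 3] .
  show "f x (y + y') z = f x y z + f x y' z" "f x 0 z = 0" "f x (- y) z = - f x y z"
    "f x (y - y') z = f x y z - f x y' z" "f x (s2 k y) z = s4 k (f x y z)"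
    using linear_simps[OF 2] .
  show "f x y (z + z') = f x y z + f x y z'" "f x y 0 = 0" "f x y (- z) = - f x y z"
    "f x y (z - z') = f x y z - f x y z'" "f x y (s3 k z) = s4 k (f x y z)"
    using linear_simps[OF 1] .
qed

lemma bilinear_mapI:
  assumes "vector_space s1" "vector_space s2" "vector_space s3"
    and "\<And>x x' y. f (x + x') y = f x y + f x' y" "\<And>k x y. f (s1 k x) y = s3 k (f x y)"
    and "\<And>x y y'. f x (y + y') = f x y + f x y'" "\<And>k x y. f x (s2 k y) = s3 k (f x y)"
  shows "bilinear_map s1 s2 s3 f"
  using assms by (simp add: bilinear_map_def Vector_Spaces.linear_iff)

lemma trilinear_mapI:
  assumes "vector_space s1" "vector_space s2" "vector_space s3" "vector_space s4"
    and "\<And>x x' y z. f (x + x') y z = f x y z + f x' y z" "\<And>k x y z. f (s1 k x) y z = s4 k (f x y z)"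
    and "\<And>x y y' z. f x (y + y') z = f x y z + f x y' z" "\<And>k x y z. f x (s2 k y) z = s4 k (f x y z)"
    and "\<And>x y z z'. f x y (z + z') = f x y z + f x y z'" "\<And>k x y z. f x y (s3 k z) = s4 k (f x y z)"
  shows "trilinear_map s1 s2 s3 s4 f"
  using assms by (simp add: trilinear_map_def Vector_Spaces.linear_iff)

text \<open>Two is invertible in characteristic zero. Skew-symmetry of the brackets only yields
  \<open>x = - x\<close> on equal arguments, while \<open>C2\<close> asks for cochains that vanish
  there.\<close>

lemma double_eq_0D:
  fixes s :: "'k::field_char_0 \<Rightarrow> 'a::ab_group_add \<Rightarrow> 'a" and x :: 'a
  assumes "vector_space s" "x = - x"
  shows "x = 0"
proof -
  interpret vector_space s by fact
  have "s 2 x = x + x" using scale_left_distrib[of 1 1 x] by simp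
  also have "\<dots> = 0" using assms(2) by (metis add.right_inverse)
  finally show ?thesis by simp
qed

section \<open>Algebras and representations\<close>

lemma mrb_lie_yamagutiD:
  assumes "mrb_lie_yamaguti A"
  shows "brk A x y = - brk A y x"
    and "trp A x y z = - trp A y x z"
    and "brk A (brk A x y) z + brk A (brk A y z) x + brk A (brk A z x) y
        + trp A x y z + trp A y z x + trp A z x y = 0"
    and "trp A (brk A x y) z a + trp A (brk A z x) y a + trp A (brk A y z) x a = 0"
    and "trp A a b (brk A x y) = brk A (trp A a b x) y + brk A x (trp A a b y)"
    and "trp A a b (trp A x y z) =
        trp A (trp A a b x) y z + trp A x (trp A a b y) z + trp A x y (trp A a b z)"
    and "brk A (rbo A x) (rbo A y) =
        rbo A (brk A (rbo A x) y + brk A x (rbo A y)) - brk A x y"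
    and "trp A (rbo A x) (rbo A y) (rbo A z) =
        rbo A (trp A x (rbo A y) (rbo A z) + trp A (rbo A x) y (rbo A z)
               + trp A (rbo A x) (rbo A y) z + trp A x y z)
        - trp A (rbo A x) y z - trp A x (rbo A y) z - trp A x y (rbo A z)"
  using assms unfolding mrb_lie_yamaguti_def lie_yamaguti_def by iprover+

lemma mrb_lie_yamaguti_linear:
  assumes "mrb_lie_yamaguti A"
  shows "vector_space (scl A)" "bilinear_map (scl A) (scl A) (scl A) (brk A)"
    "trilinear_map (scl A) (scl A) (scl A) (scl A) (trp A)"
    "Vector_Spaces.linear (scl A) (scl A) (rbo A)"
  using assms unfolding mrb_lie_yamaguti_def lie_yamaguti_def by iprover+

section \<open>Homomorphisms and isomorphisms\<close>

lemma mrbly_homD: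
  assumes "mrbly_hom A B f"
  shows "Vector_Spaces.linear (scl A) (scl B) f" "f (brk A x y) = brk B (f x) (f y)"
    "f (trp A x y z) = trp B (f x) (f y) (f z)" "f (rbo A x) = rbo B (f x)"
  using assms by (simp_all add: mrbly_hom_def)

text \<open>Every axiom is an identity between expressions in the operations. Injectivity allows
  both sides to be compared after applying \<open>f\<close>, and there the identity is the same
  axiom of \<open>B\<close> at the images of the arguments.\<close>

lemma mrb_lie_yamaguti_inj_hom:
  assumes B: "mrb_lie_yamaguti B" and f: "mrbly_hom A B f" and "inj f"
  shows "mrb_lie_yamaguti A"
proof -
  have lin: "Vector_Spaces.linear (scl A) (scl B) f"
    using f by (simp add: mrbly_hom_def)
  have vs: "vector_space (scl A)" "vector_space (scl B)"
    using lin by (auto simp: Vector_Spaces.linear_iff)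
  have fs: "f (brk A x y) = brk B (f x) (f y)" "f (trp A x y z) = trp B (f x) (f y) (f z)"
    "f (rbo A x) = rbo B (f x)" for x y z
    using f by (simp_all add: mrbly_hom_def)
  note fl = linear_simps[OF lin]
  have eqI: "x = y \<longleftrightarrow> f x = f y" for x y
    using \<open>inj f\<close> by (auto dest: injD)
  note linB = mrb_lie_yamaguti_linear[OF B]
  note lB = bilinear_map_simps[OF linB(2)] trilinear_map_simps[OF linB(3)] linear_simps[OF linB(4)]
  have bA: "bilinear_map (scl A) (scl A) (scl A) (brk A)"
    by (rule bilinear_mapI) (simp_all add: vs eqI fs fl lB)
  have tA: "trilinear_map (scl A) (scl A) (scl A) (scl A) (trp A)"
    by (rule trilinear_mapI) (simp_all add: vs eqI fs fl lB)
  have rA: "Vector_Spaces.linear (scl A) (scl A) (rbo A)"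
    by (simp add: Vector_Spaces.linear_iff vs eqI fs fl lB)
  show ?thesis
    unfolding mrb_lie_yamaguti_def lie_yamaguti_def
    by (intro conjI allI; (rule vs(1) bA tA rA | (simp only: eqI fs fl, rule mrb_lie_yamagutiD[OF B])))
qed

lemma mrbly_iso_id: "mrb_lie_yamaguti A \<Longrightarrow> mrbly_iso A A id"
  by (simp add: mrbly_iso_def mrbly_hom_def Vector_Spaces.linear_iff mrb_lie_yamaguti_linear)

lemma mrbly_iso_comp: "mrbly_iso A B f \<Longrightarrow> mrbly_iso B C g \<Longrightarrow> mrbly_iso A C (g \<circ> f)"
  by (auto simp: mrbly_iso_def mrbly_hom_def Vector_Spaces.linear_iff bij_comp)

lemma mrbly_iso_inv:
  assumes "mrbly_iso A B f"
  shows "mrbly_iso B A (inv f)"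
proof -
  have "bij f" and f: "mrbly_hom A B f" using assms by (auto simp: mrbly_iso_def)
  have eq: "inv f y = x \<longleftrightarrow> y = f x" for x y
    using \<open>bij f\<close> by (metis bij_inv_eq_iff)
  have "f (inv f y) = y" for y using eq by metis
  with f \<open>bij f\<close> show ?thesis
    by (auto simp: mrbly_iso_def mrbly_hom_def Vector_Spaces.linear_iff eq bij_imp_bij_inv)
qed

section \<open>Identities in a fixed algebra with a fixed representation\<close>

locale mrbly_rep =
  fixes L :: "('k::field_char_0, 'l::ab_group_add) mrbly"
    and V :: "('k, 'v::ab_group_add) mrbly"
    and M :: "('l, 'v) rep"
  assumes L: "mrb_lie_yamaguti L" and M: "mrb_representation L V M"
begin

lemma lin:
  shows vsL: "vector_space (scl L)" and vsV: "vector_space (scl V)"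
    and brk: "bilinear_map (scl L) (scl L) (scl L) (brk L)"
    and trp: "trilinear_map (scl L) (scl L) (scl L) (scl L) (trp L)"
    and rboL: "Vector_Spaces.linear (scl L) (scl L) (rbo L)"
    and rho: "bilinear_map (scl L) (scl V) (scl V) (rho M)"
    and theta: "trilinear_map (scl L) (scl L) (scl V) (scl V) (theta M)"
    and dop: "trilinear_map (scl L) (scl L) (scl V) (scl V) (dop M)"
    and rboV: "Vector_Spaces.linear (scl V) (scl V) (rbo V)"
  using L M unfolding mrb_lie_yamaguti_def lie_yamaguti_def mrb_representation_def ly_representation_def
  by iprover+

lemmas linear_rules = vector_space_simps[OF vsL] vector_space_simps[OF vsV]
  bilinear_map_simps[OF brk] trilinear_map_simps[OF trp] linear_simps[OF rboL]
  bilinear_map_simps[OF rho] trilinear_map_simps[OF theta] trilinear_map_simps[OF dop] linear_simps[OF rboV]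

lemma
  shows brk_skew: "brk L x y = - brk L y x"
    and trp_skew: "trp L x y z = - trp L y x z"
    and LY3: "brk L (brk L x y) z + brk L (brk L y z) x + brk L (brk L z x) y
        + trp L x y z + trp L y z x + trp L z x y = 0"
    and LY4: "trp L (brk L x y) z a + trp L (brk L z x) y a + trp L (brk L y z) x a = 0"
    and LY5: "trp L a b (brk L x y) = brk L (trp L a b x) y + brk L x (trp L a b y)"
    and LY6: "trp L a b (trp L x y z) =
        trp L (trp L a b x) y z + trp L x (trp L a b y) z + trp L x y (trp L a b z)"
    and RB2: "brk L (rbo L x) (rbo L y) =
        rbo L (brk L (rbo L x) y + brk L x (rbo L y)) - brk L x y"
    and RB3: "trp L (rbo L x) (rbo L y) (rbo L z) =
        rbo L (trp L x (rbo L y) (rbo L z) + trp L (rbo L x) y (rbo L z)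
               + trp L (rbo L x) (rbo L y) z + trp L x y z)
        - trp L (rbo L x) y z - trp L x (rbo L y) z - trp L x y (rbo L z)"
  by (rule mrb_lie_yamagutiD[OF L])+

lemma
  shows R1: "dop M x y u - theta M y x u + theta M x y u + rho M (brk L x y) u
        - rho M x (rho M y u) + rho M y (rho M x u) = 0"
    and R2: "dop M (brk L x y) z u + dop M (brk L y z) x u + dop M (brk L z x) y u = 0"
    and R3: "theta M (brk L x y) a u = theta M x a (rho M y u) - theta M y a (rho M x u)"
    and R4: "dop M a b (rho M x u) = rho M x (dop M a b u) + rho M (trp L a b x) u"
    and R5: "theta M x (brk L a b) u = rho M a (theta M x b u) - rho M b (theta M x a u)"
    and R6: "dop M a b (theta M x y u) =
        theta M x y (dop M a b u) + theta M (trp L a b x) y u + theta M x (trp L a b y) u"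
    and R7: "theta M a (trp L x y z) u =
        theta M y z (theta M a x u) - theta M x z (theta M a y u) + dop M x y (theta M a z u)"
    and RBrho: "rho M (rbo L x) (rbo V u) =
        rbo V (rho M (rbo L x) u + rho M x (rbo V u)) - rho M x u"
    and RBtheta: "theta M (rbo L x) (rbo L y) (rbo V u) =
        rbo V (theta M (rbo L x) (rbo L y) u + theta M (rbo L x) y (rbo V u)
               + theta M x (rbo L y) (rbo V u) + theta M x y u)
        - theta M (rbo L x) y u - theta M x y (rbo V u) - theta M x (rbo L y) u"
  using M unfolding mrb_representation_def ly_representation_def by iprover+

text \<open>Since (R1) expresses \<open>D\<close> through \<open>\<rho>\<close> and \<open>\<theta>\<close>, the identities for \<open>D\<close> that are not among the
  axioms of a representation follow from those for \<open>\<rho>\<close> and \<open>\<theta>\<close>.\<close>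

lemma dop_eq: "dop M x y u = theta M y x u - theta M x y u - rho M (brk L x y) u
        + rho M x (rho M y u) - rho M y (rho M x u)"
  using R1[of x y u] by (simp add: algebra_simps)

lemma dop_skew: "dop M x y u = - dop M y x u"
  unfolding dop_eq[of x y] dop_eq[of y x] brk_skew[of x y] by (simp add: linear_rules)

lemma dop_dop: "dop M a b (dop M x y u) =
    dop M x y (dop M a b u) + dop M (trp L a b x) y u + dop M x (trp L a b y) u"
  \<comment> \<open>The operator \<open>dop M a b\<close> is kept unexpanded: by R4, R6 and LY5 it
    acts as a derivation on each term of the expansion of \<open>dop M x y\<close>.\<close>
  unfolding dop_eq[of x y] dop_eq[of "trp L a b x"] dop_eq[of x "trp L a b y"]
  by (simp add: linear_rules R4 R6 LY5 algebra_simps)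

lemma RBdop: "dop M (rbo L x) (rbo L y) (rbo V u) =
        rbo V (dop M (rbo L x) (rbo L y) u + dop M (rbo L x) y (rbo V u)
               + dop M x (rbo L y) (rbo V u) + dop M x y u)
        - dop M (rbo L x) y u - dop M x y (rbo V u) - dop M x (rbo L y) u"
  unfolding dop_eq
  by (simp add: RB2 RBrho RBtheta linear_rules algebra_simps)

end

section \<open>The algebra attached to a cochain\<close>

text \<open>With the zero cochain this is the semidirect product. \<open>theta M y z u\<close>
  models the triple bracket with \<open>u\<close> in first place and \<open>dop\<close> the one with
  \<open>u\<close> in last place; for \<open>u\<close> in the middle, (LY2) reduces to the first
  case with a minus sign. Products with two entries from \<open>V\<close> contribute nothing, which
  makes \<open>V\<close> an abelian ideal.\<close>

definition cochain_alg ::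
  "('k, 'l::ab_group_add) mrbly \<Rightarrow> ('k, 'v::ab_group_add) mrbly \<Rightarrow> ('l, 'v) rep \<Rightarrow>
   ('l, 'v) cochain2 \<Rightarrow> ('k, 'l \<times> 'v) mrbly" where
  "cochain_alg L V M = (\<lambda>((f, g), h). \<lparr>
     scl = (\<lambda>k p. (scl L k (fst p), scl V k (snd p))),
     brk = (\<lambda>p q. (brk L (fst p) (fst q),
              rho M (fst p) (snd q) - rho M (fst q) (snd p) + f (fst p) (fst q))),
     trp = (\<lambda>p q r. (trp L (fst p) (fst q) (fst r),
              dop M (fst p) (fst q) (snd r) + theta M (fst q) (fst r) (snd p)
              - theta M (fst p) (fst r) (snd q) + g (fst p) (fst q) (fst r))),
     rbo = (\<lambda>p. (rbo L (fst p), rbo V (snd p) + h (fst p)))\<rparr>)"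

text \<open>These extensions are the standard models: their carrier depends only on \<open>L\<close>
  and \<open>V\<close>, so a single type holds a representative of every equivalence class.\<close>

definition cochain_ext ::
  "('k, 'l::ab_group_add) mrbly \<Rightarrow> ('k, 'v::ab_group_add) mrbly \<Rightarrow> ('l, 'v) rep \<Rightarrow>
   ('l, 'v) cochain2 \<Rightarrow> ('k, 'l, 'v, 'l \<times> 'v) extension" where
  "cochain_ext L V M c = \<lparr>mid = cochain_alg L V M c, inc = (\<lambda>u. (0, u)), prj = fst\<rparr>"

lemma cochain_alg_simps:
  "scl (cochain_alg L V M ((f, g), h)) k p = (scl L k (fst p), scl V k (snd p))"
  "brk (cochain_alg L V M ((f, g), h)) p q = (brk L (fst p) (fst q),
     rho M (fst p) (snd q) - rho M (fst q) (snd p) + f (fst p) (fst q))"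
  "trp (cochain_alg L V M ((f, g), h)) p q r = (trp L (fst p) (fst q) (fst r),
     dop M (fst p) (fst q) (snd r) + theta M (fst q) (fst r) (snd p)
     - theta M (fst p) (fst r) (snd q) + g (fst p) (fst q) (fst r))"
  "rbo (cochain_alg L V M ((f, g), h)) p = (rbo L (fst p), rbo V (snd p) + h (fst p))"
  by (simp_all add: cochain_alg_def)

section \<open>Cocycle conditions as axioms of the cochain algebra\<close>

context mrbly_rep
begin

text \<open>After multilinearity and alternation, the identities match axioms of
  \<open>cochain_alg\<close> in this order: (LY5) and (LY6) from \<open>delta2\<close>, the two
  operator identities from \<open>partial1\<close> and \<open>Phi2\<close>, (LY3) and (LY4) from
  \<open>delta_star\<close>.\<close>

lemma mem_Z2_iff: "((f, g), h) \<in> Z2 L V M \<longleftrightarrow>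
   bilinear_map (scl L) (scl L) (scl V) f \<and> (\<forall>x. f x x = 0) \<and>
   trilinear_map (scl L) (scl L) (scl L) (scl V) g \<and> (\<forall>x z. g x x z = 0) \<and>
   Vector_Spaces.linear (scl L) (scl V) h \<and>
   (\<forall>a b x y. - rho M x (g a b y) + rho M y (g a b x) + g a b (brk L x y)
         + dop M a b (f x y) - f (trp L a b x) y - f x (trp L a b y) = 0) \<and>
   (\<forall>a b x y z. - theta M y z (g a b x) + theta M x z (g a b y)
         + dop M a b (g x y z) - dop M x y (g a b z)
         - g (trp L a b x) y z - g x (trp L a b y) z - g x y (trp L a b z)
         + g a b (trp L x y z) = 0) \<and>
   (\<forall>x y. - (rho M (rbo L x) (h y) - rbo V (rho M x (h y)) - (rho M (rbo L y) (h x) - rbo V (rho M y (h x)))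
         - h (brk L (rbo L x) y + brk L x (rbo L y)))
         - (f (rbo L x) (rbo L y) + f x y - rbo V (f (rbo L x) y + f x (rbo L y))) = 0) \<and>
   (\<forall>x y z. - ((dop M (rbo L x) (rbo L y) (h z) + dop M x y (h z)
           - rbo V (dop M (rbo L x) y (h z) + dop M x (rbo L y) (h z)))
         + (theta M (rbo L y) (rbo L z) (h x) + theta M y z (h x)
           - rbo V (theta M (rbo L y) z (h x) + theta M y (rbo L z) (h x)))
         - (theta M (rbo L x) (rbo L z) (h y) + theta M x z (h y)
           - rbo V (theta M (rbo L x) z (h y) + theta M x (rbo L z) (h y)))
         - h (trp L x (rbo L y) (rbo L z) + trp L (rbo L x) y (rbo L z)
                     + trp L (rbo L x) (rbo L y) z + trp L x y z))
         - (g (rbo L x) (rbo L y) (rbo L z) + g (rbo L x) y z + g x (rbo L y) z + g x y (rbo L z)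
         - rbo V (g (rbo L x) (rbo L y) z + g (rbo L x) y (rbo L z)
                  + g x (rbo L y) (rbo L z) + g x y z)) = 0) \<and>
   (\<forall>x y z. - rho M x (f y z) - rho M y (f z x) - rho M z (f x y)
         + f (brk L x y) z + f (brk L y z) x + f (brk L z x) y
         + g x y z + g y z x + g z x y = 0) \<and>
   (\<forall>x y z a. theta M x a (f y z) + theta M y a (f z x) + theta M z a (f x y)
         + g (brk L x y) z a + g (brk L y z) x a + g (brk L z x) y a = 0)"
  unfolding Z2_def C2_def d2_def delta_star_def delta2_def partial1_def delta1_def desc_mrbly_def
      desc_rep_def Phi2_def
  by (simp add: fun_eq_iff prod_eq_iff)

lemma vector_space_cochain_alg: "vector_space (scl (cochain_alg L V M ((f, g), h)))"
proof -
  interpret L: vector_space "scl L" by (rule vsL)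
  interpret V: vector_space "scl V" by (rule vsV)
  show ?thesis
    by unfold_locales
      (simp_all add: cochain_alg_simps prod_eq_iff L.scale_right_distrib V.scale_right_distrib
        L.scale_left_distrib V.scale_left_distrib)
qed

text \<open>The first component of each axiom is the axiom of \<open>L\<close>. In the second
  component, the terms with an entry from \<open>V\<close> cancel by the identities of the
  representation, and the terms in \<open>f\<close>, \<open>g\<close>, \<open>h\<close> by the
  cocycle condition that belongs to the axiom.\<close>

lemma mrb_lie_yamaguti_cochain_alg:
  assumes c: "((f, g), h) \<in> Z2 L V M"
  shows "mrb_lie_yamaguti (cochain_alg L V M ((f, g), h))" (is "mrb_lie_yamaguti ?A")
proof -
  have f: "bilinear_map (scl L) (scl L) (scl V) f" and f0: "f x x = 0"
    and g: "trilinear_map (scl L) (scl L) (scl L) (scl V) g" and g0: "g x x z = 0"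
    and h: "Vector_Spaces.linear (scl L) (scl V) h" for x z
    using c unfolding mem_Z2_iff by iprover+
  \<comment> \<open>Each condition is solved for one term, here and in \<open>c3\<close> and
    \<open>c4\<close>, so that this term can be eliminated from the corresponding axiom.\<close>
  have c1: "g a b (brk L x y) = rho M x (g a b y) - rho M y (g a b x)
         - dop M a b (f x y) + f (trp L a b x) y + f x (trp L a b y)"
    and c2: "g a b (trp L x y z) = theta M y z (g a b x) - theta M x z (g a b y)
         - dop M a b (g x y z) + dop M x y (g a b z)
         + g (trp L a b x) y z + g x (trp L a b y) z + g x y (trp L a b z)"
    and c5: "g x y z = rho M x (f y z) + rho M y (f z x) + rho M z (f x y)
         - f (brk L x y) z - f (brk L y z) x - f (brk L z x) y - g y z x - g z x y" for a b x y z
    using c unfolding mem_Z2_iff by (simp_all add: algebra_simps)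
  have c6: "theta M x a (f y z) + theta M y a (f z x) + theta M z a (f x y)
         + g (brk L x y) z a + g (brk L y z) x a + g (brk L z x) y a = 0" for x y z a
    using c unfolding mem_Z2_iff by iprover
  note rules = linear_rules bilinear_map_simps[OF f] trilinear_map_simps[OF g] linear_simps[OF h]
  have c3: "f (rbo L x) (rbo L y) = - (rho M (rbo L x) (h y) - rbo V (rho M x (h y))
         - (rho M (rbo L y) (h x) - rbo V (rho M y (h x))))
         + h (brk L (rbo L x) y + brk L x (rbo L y))
         - f x y + rbo V (f (rbo L x) y + f x (rbo L y))" for x y
    using c unfolding mem_Z2_iff by (simp add: rules algebra_simps)
  have c4: "g (rbo L x) (rbo L y) (rbo L z) = - ((dop M (rbo L x) (rbo L y) (h z) + dop M x y (h z)
           - rbo V (dop M (rbo L x) y (h z) + dop M x (rbo L y) (h z)))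
         + (theta M (rbo L y) (rbo L z) (h x) + theta M y z (h x)
           - rbo V (theta M (rbo L y) z (h x) + theta M y (rbo L z) (h x)))
         - (theta M (rbo L x) (rbo L z) (h y) + theta M x z (h y)
           - rbo V (theta M (rbo L x) z (h y) + theta M x (rbo L z) (h y)))
         - h (trp L x (rbo L y) (rbo L z) + trp L (rbo L x) y (rbo L z)
                     + trp L (rbo L x) (rbo L y) z + trp L x y z))
         - g (rbo L x) y z - g x (rbo L y) z - g x y (rbo L z)
         + rbo V (g (rbo L x) (rbo L y) z + g (rbo L x) y (rbo L z)
                  + g x (rbo L y) (rbo L z) + g x y z)" for x y z
    using c unfolding mem_Z2_iff by (simp add: rules algebra_simps)
  \<comment> \<open>Polarization, here and for \<open>g\<close>: expand the value at the repeated
    argument \<open>x + y\<close>.\<close>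
  have fskew: "f x y = - f y x" for x y
    using f0[of x] f0[of y] f0[of "x + y"] by (simp add: rules eq_neg_iff_add_eq_0 add.commute)
  have gskew: "g x y z = - g y x z" for x y z
    using g0[of x] g0[of y] g0[of "x + y" z] by (simp add: rules eq_neg_iff_add_eq_0 add.commute)
  note vs = vsL vsV vector_space_cochain_alg
  note cs = cochain_alg_simps prod_eq_iff
  have 1: "bilinear_map (scl ?A) (scl ?A) (scl ?A) (brk ?A)"
    by (rule bilinear_mapI) (simp_all add: vs cs rules algebra_simps)
  have 2: "trilinear_map (scl ?A) (scl ?A) (scl ?A) (scl ?A) (trp ?A)"
    by (rule trilinear_mapI) (simp_all add: vs cs rules algebra_simps)
  have 3: "Vector_Spaces.linear (scl ?A) (scl ?A) (rbo ?A)"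
    by (simp add: Vector_Spaces.linear_iff vs cs rules algebra_simps)
  have 4: "brk ?A p q = - brk ?A q p" for p q
    using brk_skew[of "fst p" "fst q"] fskew[of "fst p" "fst q"] by (simp add: cs)
  have 5: "trp ?A p q r = - trp ?A q p r" for p q r
    using trp_skew[of "fst p" "fst q"] gskew[of "fst p" "fst q"] dop_skew[of "fst p" "fst q"]
    by (simp add: cs)
  have 6: "brk ?A (brk ?A x y) z + brk ?A (brk ?A y z) x + brk ?A (brk ?A z x) y
        + trp ?A x y z + trp ?A y z x + trp ?A z x y = 0" for x y z
    using LY3[of "fst x" "fst y" "fst z"] c5[where x = "fst x" and y = "fst y" and z = "fst z"]
    by (simp add: cs rules dop_eq[of _ _ "snd _"])
  have 7: "trp ?A (brk ?A x y) z a + trp ?A (brk ?A z x) y a + trp ?A (brk ?A y z) x a = 0" for x y z a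
    using LY4[of "fst x" "fst y" "fst z" "fst a"] R2[of "fst x" "fst y" "fst z" "snd a"]
     c6[where x = "fst x" and y = "fst y" and z = "fst z" and a = "fst a"]
    by (simp add: cs rules R3 algebra_simps)
  have 8: "trp ?A a b (brk ?A x y) = brk ?A (trp ?A a b x) y + brk ?A x (trp ?A a b y)" for a b x y
    by (simp add: cs rules LY5 R4 R5 c1 algebra_simps)
  \<comment> \<open>\<open>LY6\<close>, \<open>R6\<close>, \<open>R7\<close>, \<open>c2\<close> and \<open>dop_dop\<close> do not terminate as rewrite rules unless instantiated.\<close>
  have 9: "trp ?A a b (trp ?A x y z) =
        trp ?A (trp ?A a b x) y z + trp ?A x (trp ?A a b y) z + trp ?A x y (trp ?A a b z)" for a b x y z
    by (simp add: cs rules LY6[of "fst a" "fst b" "fst x" "fst y"] R6[of "fst a" "fst b"] R7[of _ "fst x" "fst y" "fst z"] dop_dop[of "fst a" "fst b" "fst x" "fst y"]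
        c2[where a = "fst a" and b = "fst b" and x = "fst x" and y = "fst y"] algebra_simps)
  have 10: "brk ?A (rbo ?A x) (rbo ?A y) =
        rbo ?A (brk ?A (rbo ?A x) y + brk ?A x (rbo ?A y)) - brk ?A x y" for x y
    by (simp add: cs rules RB2 RBrho c3 algebra_simps)
  have 11: "trp ?A (rbo ?A x) (rbo ?A y) (rbo ?A z) =
        rbo ?A (trp ?A x (rbo ?A y) (rbo ?A z) + trp ?A (rbo ?A x) y (rbo ?A z)
               + trp ?A (rbo ?A x) (rbo ?A y) z + trp ?A x y z)
        - trp ?A (rbo ?A x) y z - trp ?A x (rbo ?A y) z - trp ?A x y (rbo ?A z)" for x y z
    by (simp add: cs rules RB3 RBdop RBtheta c4 algebra_simps)
  show ?thesis
    unfolding mrb_lie_yamaguti_def lie_yamaguti_def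
    by (intro conjI allI) (fact vector_space_cochain_alg 1 2 3 4 5 6 7 8 9 10 11)+
qed

text \<open>At arguments of the form \<open>(x, 0)\<close> the second components consist only of
  terms in \<open>f\<close>, \<open>g\<close>, \<open>h\<close>. So each axiom there reads off one
  cocycle condition, and multilinearity of the operations gives that of the cochain.\<close>

lemma cochain_alg_imp_Z2:
  assumes A: "mrb_lie_yamaguti (cochain_alg L V M ((f, g), h))" (is "mrb_lie_yamaguti ?A")
  shows "((f, g), h) \<in> Z2 L V M"
proof -
  note linA = mrb_lie_yamaguti_linear[OF A]
  note bA = bilinear_map_simps[OF linA(2)] and tA = trilinear_map_simps[OF linA(3)]
    and rA = linear_simps[OF linA(4)]
  note ly = mrb_lie_yamagutiD[OF A]
  note cs = cochain_alg_simps linear_rules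
  have f: "bilinear_map (scl L) (scl L) (scl V) f"
  proof (rule bilinear_mapI)
    show "f (x + x') y = f x y + f x' y" for x x' y
      using bA(1)[of "(x, 0)" "(x', 0)" "(y, 0)"] by (simp add: cs)
    show "f x (y + y') = f x y + f x y'" for x y y'
      using bA(6)[of "(x, 0)" "(y, 0)" "(y', 0)"] by (simp add: cs)
    show "f (scl L k x) y = scl V k (f x y)" for k x y
      using bA(5)[of k "(x, 0)" "(y, 0)"] by (simp add: cs)
    show "f x (scl L k y) = scl V k (f x y)" for k x y
      using bA(10)[of "(x, 0)" k "(y, 0)"] by (simp add: cs)
  qed (rule vsL vsV)+
  have g: "trilinear_map (scl L) (scl L) (scl L) (scl V) g"
  proof (rule trilinear_mapI)
    show "g (x + x') y z = g x y z + g x' y z" for x x' y z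
      using tA(1)[of "(x, 0)" "(x', 0)" "(y, 0)" "(z, 0)"] by (simp add: cs)
    show "g x (y + y') z = g x y z + g x y' z" for x y y' z
      using tA(6)[of "(x, 0)" "(y, 0)" "(y', 0)" "(z, 0)"] by (simp add: cs)
    show "g x y (z + z') = g x y z + g x y z'" for x y z z'
      using tA(11)[of "(x, 0)" "(y, 0)" "(z, 0)" "(z', 0)"] by (simp add: cs)
    show "g (scl L k x) y z = scl V k (g x y z)" for k x y z
      using tA(5)[of k "(x, 0)" "(y, 0)" "(z, 0)"] by (simp add: cs)
    show "g x (scl L k y) z = scl V k (g x y z)" for k x y z
      using tA(10)[of "(x, 0)" k "(y, 0)" "(z, 0)"] by (simp add: cs)
    show "g x y (scl L k z) = scl V k (g x y z)" for k x y z
      using tA(15)[of "(x, 0)" "(y, 0)" k "(z, 0)"] by (simp add: cs)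
  qed (rule vsL vsV)+
  have h: "Vector_Spaces.linear (scl L) (scl V) h"
  proof -
    have "h (x + y) = h x + h y" for x y
      using rA(1)[of "(x, 0)" "(y, 0)"] by (simp add: cs)
    moreover have "h (scl L k x) = scl V k (h x)" for k x
      using rA(5)[of k "(x, 0)"] by (simp add: cs)
    ultimately show ?thesis
      by (simp add: Vector_Spaces.linear_iff vsL vsV)
  qed
  have f0: "f x x = 0" for x
    using ly(1)[of "(x, 0)" "(x, 0)"] by (intro double_eq_0D[OF vsV]) (simp add: cs)
  have g0: "g x x z = 0" for x z
    using ly(2)[of "(x, 0)" "(x, 0)" "(z, 0)"] by (intro double_eq_0D[OF vsV]) (simp add: cs)
  note rules = cs bilinear_map_simps[OF f] trilinear_map_simps[OF g] linear_simps[OF h]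
  show ?thesis
    unfolding mem_Z2_iff
  proof (intro conjI allI f g h f0 g0)
    fix a b x y z
    show "- rho M x (g a b y) + rho M y (g a b x) + g a b (brk L x y)
        + dop M a b (f x y) - f (trp L a b x) y - f x (trp L a b y) = 0"
      using ly(5)[where a = "(a, 0)" and b = "(b, 0)" and x = "(x, 0)" and y = "(y, 0)"]
      by (simp add: rules algebra_simps)
    show "- theta M y z (g a b x) + theta M x z (g a b y)
         + dop M a b (g x y z) - dop M x y (g a b z)
         - g (trp L a b x) y z - g x (trp L a b y) z - g x y (trp L a b z)
         + g a b (trp L x y z) = 0"
      using ly(6)[where a = "(a, 0)" and b = "(b, 0)" and x = "(x, 0)" and y = "(y, 0)" and z = "(z, 0)"]
      by (simp add: rules algebra_simps)
    show "- (rho M (rbo L x) (h y) - rbo V (rho M x (h y)) - (rho M (rbo L y) (h x) - rbo V (rho M y (h x)))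
         - h (brk L (rbo L x) y + brk L x (rbo L y)))
         - (f (rbo L x) (rbo L y) + f x y - rbo V (f (rbo L x) y + f x (rbo L y))) = 0"
      using ly(7)[where x = "(x, 0)" and y = "(y, 0)"]
      by (simp add: rules algebra_simps)
    show "- ((dop M (rbo L x) (rbo L y) (h z) + dop M x y (h z)
           - rbo V (dop M (rbo L x) y (h z) + dop M x (rbo L y) (h z)))
         + (theta M (rbo L y) (rbo L z) (h x) + theta M y z (h x)
           - rbo V (theta M (rbo L y) z (h x) + theta M y (rbo L z) (h x)))
         - (theta M (rbo L x) (rbo L z) (h y) + theta M x z (h y)
           - rbo V (theta M (rbo L x) z (h y) + theta M x (rbo L z) (h y)))
         - h (trp L x (rbo L y) (rbo L z) + trp L (rbo L x) y (rbo L z)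
                     + trp L (rbo L x) (rbo L y) z + trp L x y z))
         - (g (rbo L x) (rbo L y) (rbo L z) + g (rbo L x) y z + g x (rbo L y) z + g x y (rbo L z)
         - rbo V (g (rbo L x) (rbo L y) z + g (rbo L x) y (rbo L z)
                  + g x (rbo L y) (rbo L z) + g x y z)) = 0"
      using ly(8)[where x = "(x, 0)" and y = "(y, 0)" and z = "(z, 0)"]
      by (simp add: rules algebra_simps)
    show "- rho M x (f y z) - rho M y (f z x) - rho M z (f x y)
         + f (brk L x y) z + f (brk L y z) x + f (brk L z x) y
         + g x y z + g y z x + g z x y = 0"
      using ly(3)[where x = "(x, 0)" and y = "(y, 0)" and z = "(z, 0)"]
      by (simp add: rules zero_prod_def algebra_simps)
    show "theta M x a (f y z) + theta M y a (f z x) + theta M z a (f x y)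
         + g (brk L x y) z a + g (brk L y z) x a + g (brk L z x) y a = 0"
      using ly(4)[where x = "(x, 0)" and y = "(y, 0)" and z = "(z, 0)" and a = "(a, 0)"]
      by (simp add: rules zero_prod_def algebra_simps)
  qed
qed

section \<open>Coboundaries and cohomology classes\<close>

lemma d1_add:
  "d1 L V M (h + k) = d1 L V M h + d1 L V M k"
  by (simp add: d1_def delta1_def Phi1_def fun_eq_iff linear_rules algebra_simps)

lemma d1_diff:
  "d1 L V M (h - k) = d1 L V M h - d1 L V M k"
  by (simp add: d1_def delta1_def Phi1_def fun_eq_iff linear_rules algebra_simps)

lemma C1_add: "h \<in> C1 L V \<Longrightarrow> k \<in> C1 L V \<Longrightarrow> h + k \<in> C1 L V"
  by (simp add: C1_def Vector_Spaces.linear_iff linear_rules algebra_simps)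

lemma C1_diff: "h \<in> C1 L V \<Longrightarrow> k \<in> C1 L V \<Longrightarrow> h - k \<in> C1 L V"
  by (simp add: C1_def Vector_Spaces.linear_iff linear_rules algebra_simps)

lemma zero_in_C1: "0 \<in> C1 L V"
  by (simp add: C1_def Vector_Spaces.linear_iff vsL vsV linear_rules)

lemma mem_coh_class_iff: "x \<in> coh_class L V M c \<longleftrightarrow> (\<exists>h \<in> C1 L V. x = c + d1 L V M h)"
  unfolding coh_class_def B2_def by blast

lemma coh_class_add_d1:
  assumes h: "h \<in> C1 L V"
  shows "coh_class L V M (c + d1 L V M h) = coh_class L V M c"
proof (intro equalityI subsetI)
  fix x assume "x \<in> coh_class L V M (c + d1 L V M h)"
  then obtain k where k: "k \<in> C1 L V" "x = c + d1 L V M h + d1 L V M k"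
    by (auto simp: mem_coh_class_iff)
  then have "x = c + d1 L V M (h + k)" by (simp add: d1_add add.assoc)
  with C1_add[OF h k(1)] show "x \<in> coh_class L V M c"
    by (auto simp: mem_coh_class_iff)
next
  fix x assume "x \<in> coh_class L V M c"
  then obtain k where k: "k \<in> C1 L V" "x = c + d1 L V M k"
    by (auto simp: mem_coh_class_iff)
  then have "x = c + d1 L V M h + d1 L V M (k - h)" by (simp add: d1_diff)
  with C1_diff[OF k(1) h] show "x \<in> coh_class L V M (c + d1 L V M h)"
    by (auto simp: mem_coh_class_iff)
qed

lemma coh_class_eqD:
  assumes "coh_class L V M c = coh_class L V M c'"
  obtains h where "h \<in> C1 L V" "c = c' + d1 L V M h"
proof -
  \<comment> \<open>\<open>d1_diff\<close> at \<open>0\<close> and \<open>0\<close> shows that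
    \<open>d1\<close> maps \<open>0\<close> to \<open>0\<close>, so \<open>c\<close> lies in its own
    class.\<close>
  have "c = c + d1 L V M 0" using d1_diff[of 0 0] by simp
  then have "c \<in> coh_class L V M c"
    using zero_in_C1 by (force simp: mem_coh_class_iff)
  then show ?thesis
    using that unfolding assms by (auto simp: mem_coh_class_iff)
qed

text \<open>A surjective linear map over a field has a linear right inverse, since a basis of the
  target can be lifted.\<close>

lemma ext_section_exists:
  fixes E :: "('k, 'l, 'v, 'e::ab_group_add) extension"
  assumes "E \<in> abelian_extensions L V M"
  shows "\<exists>s. ext_section L E s"
proof -
  have p: "Vector_Spaces.linear (scl (mid E)) (scl L) (prj E)" "surj (prj E)"
    using assms by (auto simp: abelian_extensions_def abelian_extension_def mrbly_hom_def)
  interpret vector_space_pair "scl (mid E)" "scl L"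
    using p by (auto simp: Vector_Spaces.linear_iff vector_space_pair_def)
  show ?thesis
    using linear_surjective_right_inverse[OF p] by (simp add: ext_section_def)
qed

end

section \<open>Extensions with a chosen section\<close>

text \<open>The section is a parameter because the arguments below compare several sections:
  \<open>s\<close>, its shift by an element of \<open>C1\<close>, and its image under an
  equivalence.\<close>

locale mrbly_ext_section = mrbly_rep L V M
  for L :: "('k::field_char_0, 'l::ab_group_add) mrbly"
    and V :: "('k, 'v::ab_group_add) mrbly" and M +
  fixes E :: "('k, 'l, 'v, 'e::ab_group_add) extension" and s :: "'l \<Rightarrow> 'e"
  assumes E: "E \<in> abelian_extensions L V M" and s: "ext_section L E s"
begin

section \<open>The ideal \<open>V\<close> in the middle algebra\<close>

lemma abelian_ext: "abelian_extension L V E"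
  using E by (simp add: abelian_extensions_def)

lemma
  shows mrb_mid: "mrb_lie_yamaguti (mid E)"
    and inc_hom: "mrbly_hom V (mid E) (inc E)"
    and prj_hom: "mrbly_hom (mid E) L (prj E)"
    and inj_inc: "inj (inc E)"
    and range_inc: "range (inc E) = {e. prj E e = 0}"
    and brk_inc: "brk (mid E) (inc E u) (inc E v) = 0"
    and trp_inc: "trp (mid E) e (inc E u) (inc E v) = 0" "trp (mid E) (inc E u) (inc E v) e = 0"
  using abelian_ext unfolding abelian_extension_def by iprover+

lemma lin_s: "Vector_Spaces.linear (scl L) (scl (mid E)) s"
  using s by (simp add: ext_section_def)

lemma prj_s [simp]: "prj E (s x) = x"
  using s by (simp add: ext_section_def fun_eq_iff)

lemma prj_inc [simp]: "prj E (inc E u) = 0"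
  using range_inc by auto

text \<open>Exactness in the middle puts \<open>e\<close> in the image of \<open>inc E\<close>.
  Outside the kernel of \<open>prj E\<close> the value of \<open>inv (inc E)\<close> carries no
  information, so each use of it needs a proof that its argument projects to zero.\<close>

lemma inc_inv: "prj E e = 0 \<Longrightarrow> inc E (inv (inc E) e) = e"
  using range_inc by (auto intro: f_inv_into_f)

lemma inv_inc [simp]: "inv (inc E) (inc E u) = u"
  using inj_inc by simp

lemmas prj_rules = linear_simps[OF mrbly_homD(1)[OF prj_hom]] mrbly_homD(2-)[OF prj_hom]

lemmas mid_linear = mrb_lie_yamaguti_linear[OF mrb_mid]

lemmas ext_rules = linear_simps[OF mrbly_homD(1)[OF inc_hom]] linear_simps[OF lin_s]
  bilinear_map_simps[OF mid_linear(2)] trilinear_map_simps[OF mid_linear(3)] linear_simps[OF mid_linear(4)]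
  vector_space_simps[OF mid_linear(1)]

lemma brk_inc_s: "brk (mid E) (inc E u) (s x) = - brk (mid E) (s x) (inc E u)"
  by (rule mrb_lie_yamagutiD[OF mrb_mid])

lemma trp_s_inc_s: "trp (mid E) (s x) (inc E u) (s y) = - trp (mid E) (inc E u) (s x) (s y)"
  by (rule mrb_lie_yamagutiD[OF mrb_mid])

text \<open>The definition of an abelian ideal speaks of adjacent entries from \<open>V\<close>;
  (LY2) brings the separated ones together.\<close>

lemma trp_inc_s_inc: "trp (mid E) (inc E u) (s x) (inc E v) = 0"
  by (subst mrb_lie_yamagutiD(2)[OF mrb_mid]) (simp add: trp_inc)

text \<open>Membership in \<open>abelian_extensions\<close> makes the induced representation equal
  to \<open>M\<close>. The brackets on the right project to brackets with a zero entry, hence to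
  zero, so the \<open>inv (inc E)\<close> in \<open>induced_rep\<close> can be undone.\<close>

lemma inc_rho: "inc E (rho M x u) = brk (mid E) (s x) (inc E u)"
  and inc_theta: "inc E (theta M x y u) = trp (mid E) (inc E u) (s x) (s y)"
  and inc_dop: "inc E (dop M x y u) = trp (mid E) (s x) (s y) (inc E u)"
proof -
  have "M = induced_rep E s"
    using E s by (simp add: abelian_extensions_def)
  then have "rho M x u = inv (inc E) (brk (mid E) (s x) (inc E u))"
    "theta M x y u = inv (inc E) (trp (mid E) (inc E u) (s x) (s y))"
    "dop M x y u = inv (inc E) (trp (mid E) (s x) (s y) (inc E u))"
    by (simp_all add: induced_rep_def)
  then show "inc E (rho M x u) = brk (mid E) (s x) (inc E u)"
    "inc E (theta M x y u) = trp (mid E) (inc E u) (s x) (s y)"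
    "inc E (dop M x y u) = trp (mid E) (s x) (s y) (inc E u)"
    by (simp_all add: inc_inv prj_rules linear_rules)
qed

section \<open>Splitting of the middle algebra by the section\<close>

lemma inc_assoc_cocycle:
  "inc E (fst (fst (assoc_cocycle L E s)) x y) = brk (mid E) (s x) (s y) - s (brk L x y)"
  "inc E (snd (fst (assoc_cocycle L E s)) x y z) = trp (mid E) (s x) (s y) (s z) - s (trp L x y z)"
  "inc E (snd (assoc_cocycle L E s) x) = rbo (mid E) (s x) - s (rbo L x)"
  by (simp_all add: assoc_cocycle_def inc_inv prj_rules)

text \<open>In the multilinear expansion at elements \<open>s x + inc E u\<close>, the terms with
  only values of \<open>s\<close> give \<open>s\<close> of the bracket in \<open>L\<close> plus the
  cochain, the terms with one entry from \<open>V\<close> give the representation, and the others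
  vanish.\<close>

lemma cochain_alg_hom:
  "mrbly_hom (cochain_alg L V M (assoc_cocycle L E s)) (mid E) (\<lambda>p. s (fst p) + inc E (snd p))"
proof -
  obtain f g h where c: "assoc_cocycle L E s = ((f, g), h)"
    by (metis surj_pair)
  have inc_c: "inc E (f x y) = brk (mid E) (s x) (s y) - s (brk L x y)"
    "inc E (g x y z) = trp (mid E) (s x) (s y) (s z) - s (trp L x y z)"
    "inc E (h x) = rbo (mid E) (s x) - s (rbo L x)" for x y z
    using inc_assoc_cocycle(1)[of x y] inc_assoc_cocycle(2)[of x y z] inc_assoc_cocycle(3)[of x] by (simp_all add: c)
  show ?thesis
    unfolding c mrbly_hom_def Vector_Spaces.linear_iff
    by (simp add: vector_space_cochain_alg mid_linear(1) cochain_alg_simps ext_rules inc_c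
        inc_rho inc_theta inc_dop brk_inc trp_inc brk_inc_s trp_s_inc_s trp_inc_s_inc
        mrbly_homD(4)[OF inc_hom] algebra_simps)
qed

lemma cochain_alg_bij: "bij (\<lambda>p. s (fst p) + inc E (snd p))"
proof (rule bijI)
  show "inj (\<lambda>p. s (fst p) + inc E (snd p))"
  proof (rule injI)
    fix p q assume eq: "s (fst p) + inc E (snd p) = s (fst q) + inc E (snd q)"
    from arg_cong[OF this, of "prj E"] have "fst p = fst q" by (simp add: prj_rules)
    with eq show "p = q" using inj_inc by (auto simp: prod_eq_iff dest: injD)
  qed
  show "surj (\<lambda>p. s (fst p) + inc E (snd p))"
  proof (rule surjI)
    \<comment> \<open>The preimage splits \<open>e\<close> into its part \<open>s (prj E e)\<close>
      along the section and a remainder in the kernel.\<close>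
    fix e show "s (fst (prj E e, inv (inc E) (e - s (prj E e))))
      + inc E (snd (prj E e, inv (inc E) (e - s (prj E e)))) = e"
      by (simp add: inc_inv prj_rules)
  qed
qed

lemma ext_equivalent_cochain_ext: "ext_equivalent (cochain_ext L V M (assoc_cocycle L E s)) E"
  unfolding ext_equivalent_def mrbly_iso_def
  by (intro exI[of _ "\<lambda>p. s (fst p) + inc E (snd p)"])
    (simp add: cochain_ext_def cochain_alg_hom cochain_alg_bij fun_eq_iff ext_rules prj_rules)

lemma assoc_cocycle_in_Z2: "assoc_cocycle L E s \<in> Z2 L V M"
proof -
  obtain f g h where c: "assoc_cocycle L E s = ((f, g), h)"
    by (metis surj_pair)
  have "mrb_lie_yamaguti (cochain_alg L V M (assoc_cocycle L E s))"
    using mrb_lie_yamaguti_inj_hom[OF mrb_mid cochain_alg_hom] cochain_alg_bij by (simp add: bij_def)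
  then show ?thesis
    unfolding c by (rule cochain_alg_imp_Z2)
qed

section \<open>Change of section\<close>

lemma ext_section_shift:
  assumes "h \<in> C1 L V"
  shows "ext_section L E (\<lambda>x. s x + inc E (h x))"
  using assms by (simp add: ext_section_def C1_def Vector_Spaces.linear_iff fun_eq_iff prj_rules
      ext_rules mid_linear(1) algebra_simps)

text \<open>The brackets are not linear in the section, but terms with two or more values of
  \<open>h\<close> vanish in the abelian ideal. What remains is linear in \<open>h\<close> and
  equals \<open>d1 L V M h\<close>; its last component \<open>rbo V (h x) - h (rbo L x)\<close>
  accounts for the minus sign at \<open>Phi1\<close>.\<close>

lemma assoc_cocycle_shift:
  assumes "h \<in> C1 L V"
  shows "assoc_cocycle L E (\<lambda>x. s x + inc E (h x)) = assoc_cocycle L E s + d1 L V M h"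
proof -
  obtain f g k where c: "assoc_cocycle L E s = ((f, g), k)"
    by (metis surj_pair)
  have inc_c: "inc E (f x y) = brk (mid E) (s x) (s y) - s (brk L x y)"
    "inc E (g x y z) = trp (mid E) (s x) (s y) (s z) - s (trp L x y z)"
    "inc E (k x) = rbo (mid E) (s x) - s (rbo L x)" for x y z
    using inc_assoc_cocycle(1)[of x y] inc_assoc_cocycle(2)[of x y z] inc_assoc_cocycle(3)[of x] by (simp_all add: c)
  have eqI: "inv (inc E) e = u" if "e = inc E u" for e u
    using that by simp
  have "inv (inc E) (brk (mid E) (s x + inc E (h x)) (s y + inc E (h y))
      - (s (brk L x y) + inc E (h (brk L x y)))) =
    f x y + (rho M x (h y) - rho M y (h x) - h (brk L x y))" for x y
    by (rule eqI) (simp add: ext_rules inc_c inc_rho brk_inc brk_inc_s)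
  moreover have "inv (inc E) (trp (mid E) (s x + inc E (h x)) (s y + inc E (h y)) (s z + inc E (h z))
      - (s (trp L x y z) + inc E (h (trp L x y z)))) =
    g x y z + (dop M x y (h z) + theta M y z (h x) - theta M x z (h y) - h (trp L x y z))" for x y z
    by (rule eqI) (simp add: ext_rules inc_c inc_theta inc_dop trp_inc trp_s_inc_s trp_inc_s_inc)
  moreover have "inv (inc E) (rbo (mid E) (s x + inc E (h x)) - (s (rbo L x) + inc E (h (rbo L x)))) =
    k x - (h (rbo L x) - rbo V (h x))" for x
    by (rule eqI) (simp add: ext_rules inc_c mrbly_homD(4)[OF inc_hom])
  ultimately show ?thesis
    unfolding c by (simp add: assoc_cocycle_def d1_def delta1_def Phi1_def fun_eq_iff)
qed

text \<open>Two sections have the same projection, so their difference takes values in the kernel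
  and pulls back along \<open>inc E\<close>.\<close>

lemma ext_section_difference:
  assumes t: "ext_section L E t"
  obtains h where "h \<in> C1 L V" "t = (\<lambda>x. s x + inc E (h x))"
proof
  define h where "h x = inv (inc E) (t x - s x)" for x
  have t': "prj E (t x) = x" for x
    using t by (simp add: ext_section_def fun_eq_iff)
  have lin_t: "Vector_Spaces.linear (scl L) (scl (mid E)) t"
    using t by (simp add: ext_section_def)
  have inc_h: "inc E (h x) = t x - s x" for x
    by (simp add: h_def inc_inv prj_rules t')
  show "t = (\<lambda>x. s x + inc E (h x))" by (simp add: inc_h)
  have eqI: "u = v" if "inc E u = inc E v" for u v
    using that inj_inc by (auto dest: injD)
  show "h \<in> C1 L V"
    unfolding C1_def Vector_Spaces.linear_iff
    by (auto intro!: eqI simp: vsL vsV inc_h ext_rules linear_simps[OF lin_t])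
qed

end

section \<open>Classification\<close>

lemma ext_equivalent_refl: "abelian_extension L V E \<Longrightarrow> ext_equivalent E E"
  unfolding ext_equivalent_def by (intro exI[of _ id]) (simp add: mrbly_iso_id abelian_extension_def)

lemma ext_equivalent_sym: "ext_equivalent E F \<Longrightarrow> ext_equivalent F E"
proof -
  assume "ext_equivalent E F"
  then obtain f where f: "mrbly_iso (mid E) (mid F) f" "f \<circ> inc E = inc F" "prj F \<circ> f = prj E"
    by (auto simp: ext_equivalent_def)
  then have fi: "inv f \<circ> f = id" "f \<circ> inv f = id"
    by (auto simp: mrbly_iso_def bij_def inj_iff surj_iff)
  have "inv f \<circ> inc F = inc E"
    unfolding f(2)[symmetric] by (simp add: o_assoc fi(1))
  moreover have "prj E \<circ> inv f = prj F"
    unfolding f(3)[symmetric] by (simp add: comp_assoc fi(2))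
  ultimately show "ext_equivalent F E"
    unfolding ext_equivalent_def using mrbly_iso_inv[OF f(1)] by blast
qed

lemma ext_equivalent_trans: "ext_equivalent E F \<Longrightarrow> ext_equivalent F G \<Longrightarrow> ext_equivalent E G"
proof -
  assume "ext_equivalent E F" "ext_equivalent F G"
  then obtain f g where
    f: "mrbly_iso (mid E) (mid F) f" "f \<circ> inc E = inc F" "prj F \<circ> f = prj E" and
    g: "mrbly_iso (mid F) (mid G) g" "g \<circ> inc F = inc G" "prj G \<circ> g = prj F"
    by (auto simp: ext_equivalent_def)
  then show "ext_equivalent E G"
    unfolding ext_equivalent_def
    by (intro exI[of _ "g \<circ> f"] conjI mrbly_iso_comp[OF f(1) g(1)]) (auto simp: fun_eq_iff)
qed

section \<open>Extensions realizing cocycles\<close>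

context mrbly_rep
begin

text \<open>Products of two elements of \<open>V\<close> vanish in the cochain algebra, so the
  inclusion is a homomorphism because \<open>V\<close> is abelian. The axioms of the middle algebra
  are the cocycle conditions.\<close>

lemma cochain_ext_abelian:
  assumes V: "abelian_mrbly V" and c: "c \<in> Z2 L V M"
  shows "cochain_ext L V M c \<in> abelian_extensions L V M"
proof -
  obtain f g h where fgh: "c = ((f, g), h)" by (metis surj_pair)
  have f: "bilinear_map (scl L) (scl L) (scl V) f"
    and g: "trilinear_map (scl L) (scl L) (scl L) (scl V) g"
    and h: "Vector_Spaces.linear (scl L) (scl V) h"
    using c unfolding fgh mem_Z2_iff by iprover+
  note rules = linear_rules bilinear_map_simps[OF f] trilinear_map_simps[OF g] linear_simps[OF h]
  have V0: "brk V u v = 0" "trp V u v w = 0" for u v w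
    using V by (auto simp: abelian_mrbly_def)
  have "mrbly_hom V (cochain_alg L V M c) (Pair 0)"
    using vector_space_cochain_alg vsV unfolding fgh mrbly_hom_def Vector_Spaces.linear_iff
    by (simp add: cochain_alg_simps rules V0)
  moreover have "mrbly_hom (cochain_alg L V M c) L fst"
    using vector_space_cochain_alg vsL unfolding fgh mrbly_hom_def Vector_Spaces.linear_iff
    by (simp add: cochain_alg_simps)
  moreover have "brk (cochain_alg L V M c) (0, u) (0, v) = 0"
    "trp (cochain_alg L V M c) e (0, u) (0, v) = 0" "trp (cochain_alg L V M c) (0, u) (0, v) e = 0" for e u v
    unfolding fgh by (simp_all add: cochain_alg_simps rules zero_prod_def)
  moreover have "range (Pair (0::'l)) = {e. fst e = (0::'l)}"
    by force
  ultimately have "abelian_extension L V (cochain_ext L V M c)"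
    using mrb_lie_yamaguti_cochain_alg c
    by (simp add: abelian_extension_def cochain_ext_def fgh inj_def)
  \<comment> \<open>The second component of \<open>s x\<close> is arbitrary, but brackets with
    \<open>(0, u)\<close> see only first components, and these are fixed by
    \<open>prj\<close>.\<close>
  moreover have "induced_rep (cochain_ext L V M c) s = M"
    if s: "ext_section L (cochain_ext L V M c) s" for s
  proof -
    have fst_s: "fst (s x) = x" for x
      using s by (simp add: ext_section_def cochain_ext_def fun_eq_iff)
    have inv: "inv (Pair (0::'l)) (0, u) = u" for u :: 'v
      by (intro inv_f_f injI) simp
    show ?thesis
      unfolding fgh
      by (simp add: induced_rep_def cochain_ext_def cochain_alg_simps rules fst_s inv)
  qed
  ultimately show ?thesis by (simp add: abelian_extensions_def)
qed

text \<open>The standard section recovers the cochain from which the extension was built;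
  surjectivity of the classification rests on this.\<close>

lemma cochain_ext_section:
  shows "ext_section L (cochain_ext L V M c) (\<lambda>x. (x, 0))"
    and "assoc_cocycle L (cochain_ext L V M c) (\<lambda>x. (x, 0)) = c"
proof -
  obtain f g h where fgh: "c = ((f, g), h)" by (metis surj_pair)
  have inv: "inv (Pair (0::'l)) (0, u) = u" for u :: 'v
    by (intro inv_f_f injI) simp
  show "ext_section L (cochain_ext L V M c) (\<lambda>x. (x, 0))"
    unfolding fgh using vector_space_cochain_alg vsL
    by (simp add: ext_section_def cochain_ext_def Vector_Spaces.linear_iff fun_eq_iff
        cochain_alg_simps linear_rules)
  show "assoc_cocycle L (cochain_ext L V M c) (\<lambda>x. (x, 0)) = c"
    unfolding fgh
    by (simp add: assoc_cocycle_def cochain_ext_def cochain_alg_simps linear_rules inv fun_eq_iff)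
qed

lemma zero_in_Z2: "0 \<in> Z2 L V M"
  unfolding zero_prod_def mem_Z2_iff
  by (auto intro!: bilinear_mapI trilinear_mapI simp: vsL vsV linear_rules Vector_Spaces.linear_iff)

text \<open>In the extension built from the cochain \<open>0\<close> the standard section has
  cocycle \<open>0\<close>, and shifting it by \<open>h\<close> adds \<open>d1 L V M h\<close>. So
  every coboundary is the cocycle of a section, which replaces a direct computation of
  \<open>d2\<close> after \<open>d1\<close>.\<close>

lemma B2_subset_Z2:
  assumes V: "abelian_mrbly V"
  shows "B2 L V M \<subseteq> Z2 L V M"
proof
  fix b assume "b \<in> B2 L V M"
  then obtain h where h: "h \<in> C1 L V" "b = d1 L V M h" by (auto simp: B2_def)
  let ?E = "cochain_ext L V M 0"
  have E: "?E \<in> abelian_extensions L V M"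
    by (rule cochain_ext_abelian[OF V zero_in_Z2])
  interpret S: mrbly_ext_section L V M ?E "\<lambda>x. (x, 0)"
    using E cochain_ext_section(1) by unfold_locales
  interpret T: mrbly_ext_section L V M ?E "\<lambda>x. (x, 0) + inc ?E (h x)"
    using E S.ext_section_shift[OF h(1)] by unfold_locales
  show "b \<in> Z2 L V M"
    using T.assoc_cocycle_in_Z2 S.assoc_cocycle_shift[OF h(1)]
    by (simp add: cochain_ext_section(2) h(2))
qed

section \<open>Extensions compared by their classes\<close>

lemma assoc_cocycle_mem_Z2:
  fixes E :: "('k, 'l, 'v, 'e::ab_group_add) extension"
  assumes E: "E \<in> abelian_extensions L V M" and s: "ext_section L E s"
  shows "assoc_cocycle L E s \<in> Z2 L V M"
proof -
  interpret mrbly_ext_section L V M E s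
    using E s by unfold_locales
  show ?thesis by (rule assoc_cocycle_in_Z2)
qed

text \<open>This lets an extension on any carrier type be replaced by one on
  \<open>'l \<times> 'v\<close>, the type on which the quotient is formed.\<close>

lemma ex_equivalent_cochain_ext:
  fixes E :: "('k, 'l, 'v, 'e::ab_group_add) extension"
  assumes V: "abelian_mrbly V" and E: "E \<in> abelian_extensions L V M"
  shows "\<exists>E' \<in> (abelian_extensions L V M :: ('k, 'l, 'v, 'l \<times> 'v) extension set). ext_equivalent E E'"
proof -
  obtain s where s: "ext_section L E s" using ext_section_exists[OF E] by blast
  interpret mrbly_ext_section L V M E s
    using E s by unfold_locales
  show ?thesis
    by (intro bexI[of _ "cochain_ext L V M (assoc_cocycle L E s)"] cochain_ext_abelian V
        assoc_cocycle_in_Z2 ext_equivalent_sym[OF ext_equivalent_cochain_ext])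
qed

text \<open>Sections differ by elements of \<open>C1\<close>, so their cocycles differ by
  coboundaries. The existence of one section \<open>s\<close> makes the description in
  \<open>ext_class\<close> unique.\<close>

lemma ext_class_eq:
  fixes E :: "('k, 'l, 'v, 'e::ab_group_add) extension"
  assumes E: "E \<in> abelian_extensions L V M" and s: "ext_section L E s"
  shows "ext_class L V M E = coh_class L V M (assoc_cocycle L E s)"
proof -
  interpret mrbly_ext_section L V M E s
    using E s by unfold_locales
  have eq: "coh_class L V M (assoc_cocycle L E s) = coh_class L V M (assoc_cocycle L E t)"
    if t: "ext_section L E t" for t
  proof -
    from t obtain h where "h \<in> C1 L V" "t = (\<lambda>x. s x + inc E (h x))"
      by (rule ext_section_difference)
    then show ?thesis
      by (simp add: assoc_cocycle_shift coh_class_add_d1)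
  qed
  show ?thesis
    unfolding ext_class_def
  proof (rule the_equality)
    show "\<forall>t. ext_section L E t \<longrightarrow>
        coh_class L V M (assoc_cocycle L E s) = coh_class L V M (assoc_cocycle L E t)"
      using eq by blast
  next
    fix c assume "\<forall>t. ext_section L E t \<longrightarrow> c = coh_class L V M (assoc_cocycle L E t)"
    with s show "c = coh_class L V M (assoc_cocycle L E s)" by blast
  qed
qed

text \<open>An equivalence carries \<open>s\<close> to a section of \<open>F\<close> with the same
  cocycle. Conversely, equal classes allow a section of \<open>F\<close> to be shifted until its
  cocycle is that of \<open>s\<close>; then \<open>E\<close> and \<open>F\<close> are equivalent to
  the same \<open>cochain_ext\<close>.\<close>

lemma ext_equivalent_iff:
  fixes E :: "('k, 'l, 'v, 'e::ab_group_add) extension"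
    and F :: "('k, 'l, 'v, 'f::ab_group_add) extension"
  assumes E: "E \<in> abelian_extensions L V M" and F: "F \<in> abelian_extensions L V M"
  shows "ext_equivalent E F \<longleftrightarrow> ext_class L V M E = ext_class L V M F"
proof
  obtain s where s: "ext_section L E s" using ext_section_exists[OF E] by blast
  interpret E: mrbly_ext_section L V M E s
    using E s by unfold_locales
  {
    assume "ext_equivalent E F"
    then obtain f where f: "mrbly_hom (mid E) (mid F) f" "f \<circ> inc E = inc F" "prj F \<circ> f = prj E"
      by (auto simp: ext_equivalent_def mrbly_iso_def)
    have fs: "ext_section L F (f \<circ> s)"
      using Vector_Spaces.linear_compose[OF E.lin_s mrbly_homD(1)[OF f(1)]] f(3) s
      by (simp add: ext_section_def o_assoc)
    interpret F: mrbly_ext_section L V M F "f \<circ> s"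
      using F fs by unfold_locales
    \<comment> \<open>Since \<open>f\<close> identifies the two copies of \<open>V\<close>, it does
      not change how elements of the kernel are read in \<open>V\<close>.\<close>
    have inv_f: "inv (inc F) (f e) = inv (inc E) e" if "prj E e = 0" for e
      using E.inc_inv[OF that] f(2) by (metis comp_apply F.inv_inc)
    note fl = linear_simps[OF mrbly_homD(1)[OF f(1)]] mrbly_homD(2-)[OF f(1)]
    have "inv (inc F) (brk (mid F) (f (s x)) (f (s y)) - f (s (brk L x y)))
        = inv (inc E) (brk (mid E) (s x) (s y) - s (brk L x y))" for x y
      using inv_f[of "brk (mid E) (s x) (s y) - s (brk L x y)"] by (simp add: E.prj_rules fl)
    moreover have "inv (inc F) (trp (mid F) (f (s x)) (f (s y)) (f (s z)) - f (s (trp L x y z)))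
        = inv (inc E) (trp (mid E) (s x) (s y) (s z) - s (trp L x y z))" for x y z
      using inv_f[of "trp (mid E) (s x) (s y) (s z) - s (trp L x y z)"] by (simp add: E.prj_rules fl)
    moreover have "inv (inc F) (rbo (mid F) (f (s x)) - f (s (rbo L x)))
        = inv (inc E) (rbo (mid E) (s x) - s (rbo L x))" for x
      using inv_f[of "rbo (mid E) (s x) - s (rbo L x)"] by (simp add: E.prj_rules fl)
    ultimately have "assoc_cocycle L F (f \<circ> s) = assoc_cocycle L E s"
      by (simp add: assoc_cocycle_def)
    then show "ext_class L V M E = ext_class L V M F"
      using ext_class_eq[OF E s] ext_class_eq[OF F fs] by simp
  }
  {
    assume eq: "ext_class L V M E = ext_class L V M F"
    obtain t where t: "ext_section L F t" using ext_section_exists[OF F] by blast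
    interpret F: mrbly_ext_section L V M F t
      using F t by unfold_locales
    from eq obtain h where h: "h \<in> C1 L V" "assoc_cocycle L E s = assoc_cocycle L F t + d1 L V M h"
      unfolding ext_class_eq[OF E s] ext_class_eq[OF F t] by (rule coh_class_eqD)
    interpret F': mrbly_ext_section L V M F "\<lambda>x. t x + inc F (h x)"
      using F F.ext_section_shift[OF h(1)] by unfold_locales
    have "assoc_cocycle L F (\<lambda>x. t x + inc F (h x)) = assoc_cocycle L E s"
      using F.assoc_cocycle_shift h by simp
    then have "ext_equivalent (cochain_ext L V M (assoc_cocycle L E s)) F"
      using F'.ext_equivalent_cochain_ext by simp
    then show "ext_equivalent E F"
      by (rule ext_equivalent_trans[OF ext_equivalent_sym[OF E.ext_equivalent_cochain_ext]])
  }
qed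

section \<open>Passage to equivalence classes\<close>

lemma equiv_ext_equiv_rel: "equiv (abelian_extensions L V M) (ext_equiv_rel L V M)"
proof (rule equivI)
  show "ext_equiv_rel L V M \<subseteq> abelian_extensions L V M \<times> abelian_extensions L V M"
    by (auto simp: ext_equiv_rel_def)
  show "refl_on (abelian_extensions L V M) (ext_equiv_rel L V M)"
    by (auto simp: refl_on_def ext_equiv_rel_def abelian_extensions_def intro: ext_equivalent_refl)
  show "sym (ext_equiv_rel L V M)"
    by (auto simp: sym_def ext_equiv_rel_def intro: ext_equivalent_sym)
  show "trans (ext_equiv_rel L V M)"
    by (auto simp: trans_def ext_equiv_rel_def intro: ext_equivalent_trans)
qed

text \<open>By \<open>ext_equivalent_iff\<close>, \<open>ext_class\<close> is constant on each
  equivalence class, so \<open>the_elem\<close> picks its only value, and it separates different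
  ones. Every cocycle is attained by its \<open>cochain_ext\<close>.\<close>

lemma bij_betw_ext_class:
  assumes V: "abelian_mrbly V"
  shows "bij_betw (\<lambda>X. the_elem (ext_class L V M ` X))
       (abelian_extensions L V M //
          (ext_equiv_rel L V M :: (('k, 'l, 'v, 'l \<times> 'v) extension \<times> _) set))
       (H2 L V M)"
proof -
  let ?A = "abelian_extensions L V M :: ('k, 'l, 'v, 'l \<times> 'v) extension set"
  let ?R = "ext_equiv_rel L V M :: (('k, 'l, 'v, 'l \<times> 'v) extension \<times> _) set"
  have class_eq: "the_elem (ext_class L V M ` (?R `` {E})) = ext_class L V M E" if "E \<in> ?A" for E
  proof -
    have "ext_class L V M ` (?R `` {E}) = {ext_class L V M E}"
      using that equiv_class_self[OF equiv_ext_equiv_rel that]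
      by (auto simp: ext_equiv_rel_def ext_equivalent_iff)
    then show ?thesis by simp
  qed
  show ?thesis
    unfolding bij_betw_def
  proof (rule conjI[OF inj_onI equalityI[OF subsetI subsetI]])
    fix X Y assume "X \<in> ?A // ?R" "Y \<in> ?A // ?R"
      and eq: "the_elem (ext_class L V M ` X) = the_elem (ext_class L V M ` Y)"
    then obtain E F where E: "E \<in> ?A" "X = ?R `` {E}" and F: "F \<in> ?A" "Y = ?R `` {F}"
      by (auto elim!: quotientE)
    have "ext_class L V M E = ext_class L V M F"
      using eq unfolding E(2) F(2) class_eq[OF E(1)] class_eq[OF F(1)] .
    then have "(E, F) \<in> ?R"
      using E F by (simp add: ext_equiv_rel_def ext_equivalent_iff)
    then show "X = Y"
      unfolding E F by (rule equiv_class_eq[OF equiv_ext_equiv_rel])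
  next
    fix x assume "x \<in> (\<lambda>X. the_elem (ext_class L V M ` X)) ` (?A // ?R)"
    then obtain E where E: "E \<in> ?A" "x = ext_class L V M E"
      by (auto elim!: quotientE simp: class_eq)
    obtain s where s: "ext_section L E s" using ext_section_exists[OF E(1)] by blast
    show "x \<in> H2 L V M"
      unfolding E(2) ext_class_eq[OF E(1) s] H2_def using assoc_cocycle_mem_Z2[OF E(1) s] by blast
  next
    fix x assume "x \<in> H2 L V M"
    then obtain c where c: "c \<in> Z2 L V M" "x = coh_class L V M c"
      by (auto simp: H2_def)
    let ?E = "cochain_ext L V M c"
    have E: "?E \<in> ?A" by (rule cochain_ext_abelian[OF V c(1)])
    have "x = the_elem (ext_class L V M ` (?R `` {?E}))"
      using ext_class_eq[OF E cochain_ext_section(1)]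
      by (simp add: class_eq[OF E] c(2) cochain_ext_section(2))
    then show "x \<in> (\<lambda>X. the_elem (ext_class L V M ` X)) ` (?A // ?R)"
      using quotientI[OF E] by blast
  qed
qed

end

text \<open>A set of equivalence classes needs a single carrier type, so the bijection is stated for
  \<open>'l \<times> 'v\<close>. The statements on individual extensions allow any carriers
  \<open>'e\<close> and \<open>'f\<close>, and the third one shows that each such extension is
  represented in the quotient.\<close>

theorem theorem7p7:
  fixes L :: "('k::{alg_closed_field, field_char_0}, 'l::ab_group_add) mrbly"
    and V :: "('k, 'v::ab_group_add) mrbly"
    and M :: "('l, 'v) rep"
  assumes "mrb_lie_yamaguti L"
    and "mrb_lie_yamaguti V" and "abelian_mrbly V"
    and "mrb_representation L V M"
  shows
    "(\<forall>E \<in> (abelian_extensions L V M :: ('k, 'l, 'v, 'e::ab_group_add) extension set).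
        (\<exists>s. ext_section L E s) \<and>
        (\<forall>s. ext_section L E s \<longrightarrow>
           assoc_cocycle L E s \<in> Z2 L V M \<and>
           coh_class L V M (assoc_cocycle L E s) = ext_class L V M E)) \<and>
     (\<forall>E1 \<in> (abelian_extensions L V M :: ('k, 'l, 'v, 'e) extension set).
      \<forall>E2 \<in> (abelian_extensions L V M :: ('k, 'l, 'v, 'f::ab_group_add) extension set).
        ext_equivalent E1 E2 \<longleftrightarrow> ext_class L V M E1 = ext_class L V M E2) \<and>
     (\<forall>E \<in> (abelian_extensions L V M :: ('k, 'l, 'v, 'e) extension set).
      \<exists>E' \<in> (abelian_extensions L V M :: ('k, 'l, 'v, 'l \<times> 'v) extension set).
        ext_equivalent E E') \<and>
     B2 L V M \<subseteq> Z2 L V M \<and>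
     equiv (abelian_extensions L V M)
       (ext_equiv_rel L V M :: (('k, 'l, 'v, 'l \<times> 'v) extension \<times> _) set) \<and>
     bij_betw (\<lambda>X. the_elem (ext_class L V M ` X))
       (abelian_extensions L V M //
          (ext_equiv_rel L V M :: (('k, 'l, 'v, 'l \<times> 'v) extension \<times> _) set))
       (H2 L V M)"
proof -
  interpret mrbly_rep L V M
    using assms by unfold_locales
  show ?thesis
  proof (intro conjI ballI allI impI)
    fix E :: "('k, 'l, 'v, 'e) extension" assume E: "E \<in> abelian_extensions L V M"
    show "\<exists>s. ext_section L E s"
      by (rule ext_section_exists[OF E])
    show "assoc_cocycle L E s \<in> Z2 L V M" if "ext_section L E s" for s
      by (rule assoc_cocycle_mem_Z2[OF E that])
    show "coh_class L V M (assoc_cocycle L E s) = ext_class L V M E" if "ext_section L E s" for s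
      by (rule ext_class_eq[OF E that, symmetric])
    show "\<exists>E' \<in> (abelian_extensions L V M :: ('k, 'l, 'v, 'l \<times> 'v) extension set). ext_equivalent E E'"
      by (rule ex_equivalent_cochain_ext[OF assms(3) E])
    show "ext_equivalent E F \<longleftrightarrow> ext_class L V M E = ext_class L V M F"
      if "F \<in> abelian_extensions L V M" for F :: "('k, 'l, 'v, 'f) extension"
      by (rule ext_equivalent_iff[OF E that])
  qed (rule B2_subset_Z2[OF assms(3)] equiv_ext_equiv_rel bij_betw_ext_class[OF assms(3)])+
qed

end
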